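(* Let $k=k(n)$ and $\epsilon>0$. If the (decision version of the) planted clique problem with parameters $p=1/2$ and $k$ is solvable in polynomial time with advantage $\epsilon$, then it is solvable in $\mathrm{FPC}$ with advantage $\epsilon-o(1)$, i.e., by a class of graphs definable by a sentence of fixed-point logic with counting (over the vocabulary of graphs, without any order).
   Context: $\mathscr{G}(n,p)$ is the Erd\H{o}s--R\'enyi distribution on labelled graphs with vertex set $[n]$ and independent edge probability $p$. $\mathscr{G}(n,p,k)$ is obtained by drawing $G\sim\mathscr{G}(n,p)$ and adding all edges of a clique on a uniformly random $k$-subset of the vertices. A class of graphs $\mathscr{C}$ solves the decision version of the planted clique problem with parameters $p$, $k$ and advantage $\epsilon$ if for all large enough $n$: $\Pr_{G\sim\mathscr{G}(n,p)}[G\in\mathscr{C}]\geq 1/2+\epsilon$ and $\Pr_{G\sim\mathscr{G}(n,p,k)}[G\in\mathscr{C}]\leq 1/2-\epsilon$. Solvable in polynomial time means by some polynomial-time decidable class; solvable in FPC means by some class defined by an FPC sentence. Advantage $\epsilon-o(1)$ means advantage $\epsilon-\delta(n)$ for some $\delta(n)\to0$. FPC is fixed-point logic with counting (the standard extension of first-order logic with inflationary fixed points and counting terms over a number sort). *)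

theory Defs
  imports
    "HOL-Probability.Probability"
    "HOL-Library.Ramsey"
    "HOL-Computational_Algebra.Polynomial"
begin

section \<open>Labelled graphs\<close>

text \<open>A pair of a number \<open>n\<close> and a set of edges stands for the labelled simple graph with vertex
  set \<open>{1..n}\<close>; edges are two-element sets of vertices. The library constant \<^const>\<open>nsets\<close>
  maps \<open>A\<close> and \<open>m\<close> to the set of all \<open>m\<close>-element subsets of \<open>A\<close>.\<close>

type_synonym graph = "nat \<times> nat set set"

definition is_graph :: "graph \<Rightarrow> bool" where
  "is_graph G \<longleftrightarrow> snd G \<subseteq> nsets {1..fst G} 2"

definition graph_iso :: "graph \<Rightarrow> graph \<Rightarrow> bool" where
  "graph_iso G H \<longleftrightarrow> fst G = fst H \<and>
     (\<exists>f. bij_betw f {1..fst G} {1..fst H} \<and> snd H = (\<lambda>e. f ` e) ` snd G)"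

text \<open>As usual in finite model theory, a class of graphs is closed under isomorphism.\<close>

definition graph_class :: "graph set \<Rightarrow> bool" where
  "graph_class C \<longleftrightarrow> (\<forall>G\<in>C. is_graph G) \<and> (\<forall>G\<in>C. \<forall>H. graph_iso G H \<longrightarrow> H \<in> C)"


section \<open>Random graphs and the planted clique problem\<close>

definition gnp :: "nat \<Rightarrow> real \<Rightarrow> graph pmf" where
  "gnp n p = map_pmf (\<lambda>f. (n, {e \<in> nsets {1..n} 2. f e}))
     (Pi_pmf (nsets {1..n} 2) False (\<lambda>_. bernoulli_pmf p))"

text \<open>Meaningful for \<open>k \<le> n\<close> only; otherwise there is no \<open>k\<close>-subset of the vertices.\<close>

definition gnpk :: "nat \<Rightarrow> real \<Rightarrow> nat \<Rightarrow> graph pmf" where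
  "gnpk n p k =
     bind_pmf (gnp n p) (\<lambda>G.
     bind_pmf (pmf_of_set (nsets {1..n} k)) (\<lambda>S.
     return_pmf (n, snd G \<union> nsets S 2)))"

text \<open>The advantage may depend on the number of vertices.\<close>

definition solves_planted_clique ::
    "real \<Rightarrow> (nat \<Rightarrow> nat) \<Rightarrow> (nat \<Rightarrow> real) \<Rightarrow> graph set \<Rightarrow> bool" where
  "solves_planted_clique p k \<epsilon> C \<longleftrightarrow>
     (\<forall>\<^sub>F n in sequentially.
        measure_pmf.prob (gnp n p) C \<ge> 1 / 2 + \<epsilon> n \<and>
        measure_pmf.prob (gnpk n p (k n)) C \<le> 1 / 2 - \<epsilon> n)"


section \<open>Polynomial time\<close>

text \<open>Deterministic one-tape Turing machines with a two-way infinite tape. The states are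
  \<open>{..<num_states M}\<close> and the tape symbols \<open>{..<num_symbols M}\<close>, where symbol \<open>0\<close> is the blank and
  symbols \<open>1\<close> and \<open>2\<close> represent the input bits \<^const>\<open>False\<close> and \<^const>\<open>True\<close>.\<close>

datatype move = Move_Left | Stay | Move_Right

record tm =
  num_states :: nat
  num_symbols :: nat
  start_state :: nat
  accept_state :: nat
  reject_state :: nat
  trans_fun :: "nat \<Rightarrow> nat \<Rightarrow> nat \<times> nat \<times> move"

definition wf_tm :: "tm \<Rightarrow> bool" where
  "wf_tm M \<longleftrightarrow>
     3 \<le> num_symbols M \<and>
     start_state M < num_states M \<and> accept_state M < num_states M \<and>
     reject_state M < num_states M \<and> accept_state M \<noteq> reject_state M \<and>
     (\<forall>q < num_states M. \<forall>a < num_symbols M.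
        case trans_fun M q a of (q', b, d) \<Rightarrow> q' < num_states M \<and> b < num_symbols M)"

text \<open>State, tape contents, head position.\<close>

type_synonym tm_config = "nat \<times> (int \<Rightarrow> nat) \<times> int"

primrec move_head :: "move \<Rightarrow> int \<Rightarrow> int" where
  "move_head Move_Left h = h - 1"
| "move_head Stay h = h"
| "move_head Move_Right h = h + 1"

fun tm_step :: "tm \<Rightarrow> tm_config \<Rightarrow> tm_config" where
  "tm_step M (q, T, h) =
     (if q = accept_state M \<or> q = reject_state M then (q, T, h)
      else case trans_fun M q (T h) of (q', b, d) \<Rightarrow> (q', T(h := b), move_head d h))"

definition tm_init :: "tm \<Rightarrow> bool list \<Rightarrow> tm_config" where
  "tm_init M w =
     (start_state M,
      \<lambda>i. if 0 \<le> i \<and> i < int (length w) then (if w ! nat i then 2 else 1) else 0,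
      0)"

definition tm_decides_in_time :: "tm \<Rightarrow> bool list set \<Rightarrow> (nat \<Rightarrow> nat) \<Rightarrow> bool" where
  "tm_decides_in_time M L T \<longleftrightarrow>
     (\<forall>w. \<exists>t \<le> T (length w).
        fst ((tm_step M ^^ t) (tm_init M w)) =
          (if w \<in> L then accept_state M else reject_state M))"

definition ptime_language :: "bool list set \<Rightarrow> bool" where
  "ptime_language L \<longleftrightarrow>
     (\<exists>M (P :: nat poly). wf_tm M \<and> tm_decides_in_time M L (poly P))"

text \<open>Graphs are presented to machines by their adjacency matrices, row by row.\<close>

definition encode_graph :: "graph \<Rightarrow> bool list" where
  "encode_graph G =
     concat (map (\<lambda>i. map (\<lambda>j. {i, j} \<in> snd G) [1..<Suc (fst G)]) [1..<Suc (fst G)])"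

definition ptime_decidable :: "graph set \<Rightarrow> bool" where
  "ptime_decidable C \<longleftrightarrow> graph_class C \<and> ptime_language (encode_graph ` C)"


section \<open>Fixed-point logic with counting\<close>

text \<open>Two-sorted logic over the vocabulary of graphs. Vertex variables range over the vertices
  \<open>{1..n}\<close> and number variables over \<open>{0..n}\<close>. The only relations available on vertices are
  equality and adjacency; although vertices are represented by natural numbers, \<open>Leq\<close> is
  restricted to terms of the number sort. Zero, successor, addition and multiplication on the number
  sort are definable from the order by inflationary fixed points.

  A variable is given by its sort and an index, a relation variable by its type (a list of sorts)
  and an index. \<open>Count i \<phi>\<close> is the number of vertices \<open>x\<close> satisfying \<open>\<phi>\<close>, for \<open>x\<close> the vertex
  variable with index \<open>i\<close>. \<open>Ifp i xs \<phi> ts\<close> says that the tuple \<open>ts\<close> is in the inflationary fixed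
  point of \<open>\<phi>\<close> with respect to the variables \<open>xs\<close> and the relation variable with index \<open>i\<close> and the
  type of \<open>xs\<close>.\<close>

datatype sort = Vertex | Number

type_synonym var = "sort \<times> nat"
type_synonym relvar = "sort list \<times> nat"

datatype fpc_term =
    Var var
  | Count nat fpc_form
and fpc_form =
    Equal fpc_term fpc_term
  | Leq fpc_term fpc_term
  | Adj fpc_term fpc_term
  | Rel relvar "fpc_term list"
  | Neg fpc_form
  | Conj fpc_form fpc_form
  | Exists var fpc_form
  | Ifp nat "var list" fpc_form "fpc_term list"

primrec sort_of :: "fpc_term \<Rightarrow> sort" where
  "sort_of (Var x) = fst x"
| "sort_of (Count i \<phi>) = Number"

primrec wf_term :: "fpc_term \<Rightarrow> bool" and wf_form :: "fpc_form \<Rightarrow> bool" where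
  "wf_term (Var x) \<longleftrightarrow> True"
| "wf_term (Count i \<phi>) \<longleftrightarrow> wf_form \<phi>"
| "wf_form (Equal s t) \<longleftrightarrow> sort_of s = sort_of t \<and> wf_term s \<and> wf_term t"
| "wf_form (Leq s t) \<longleftrightarrow> sort_of s = Number \<and> sort_of t = Number \<and> wf_term s \<and> wf_term t"
| "wf_form (Adj s t) \<longleftrightarrow> sort_of s = Vertex \<and> sort_of t = Vertex \<and> wf_term s \<and> wf_term t"
| "wf_form (Rel X ts) \<longleftrightarrow> map sort_of ts = fst X \<and> list_all (\<lambda>t. wf_term t) ts"
| "wf_form (Neg \<phi>) \<longleftrightarrow> wf_form \<phi>"
| "wf_form (Conj \<phi> \<psi>) \<longleftrightarrow> wf_form \<phi> \<and> wf_form \<psi>"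
| "wf_form (Exists x \<phi>) \<longleftrightarrow> wf_form \<phi>"
| "wf_form (Ifp i xs \<phi> ts) \<longleftrightarrow>
     distinct xs \<and> map sort_of ts = map fst xs \<and> wf_form \<phi> \<and> list_all (\<lambda>t. wf_term t) ts"

primrec fv_term :: "fpc_term \<Rightarrow> var set" and fv_form :: "fpc_form \<Rightarrow> var set" where
  "fv_term (Var x) = {x}"
| "fv_term (Count i \<phi>) = fv_form \<phi> - {(Vertex, i)}"
| "fv_form (Equal s t) = fv_term s \<union> fv_term t"
| "fv_form (Leq s t) = fv_term s \<union> fv_term t"
| "fv_form (Adj s t) = fv_term s \<union> fv_term t"
| "fv_form (Rel X ts) = \<Union> (set (map fv_term ts))"
| "fv_form (Neg \<phi>) = fv_form \<phi>"
| "fv_form (Conj \<phi> \<psi>) = fv_form \<phi> \<union> fv_form \<psi>"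
| "fv_form (Exists x \<phi>) = fv_form \<phi> - {x}"
| "fv_form (Ifp i xs \<phi> ts) = (fv_form \<phi> - set xs) \<union> \<Union> (set (map fv_term ts))"

primrec frv_term :: "fpc_term \<Rightarrow> relvar set" and frv_form :: "fpc_form \<Rightarrow> relvar set" where
  "frv_term (Var x) = {}"
| "frv_term (Count i \<phi>) = frv_form \<phi>"
| "frv_form (Equal s t) = frv_term s \<union> frv_term t"
| "frv_form (Leq s t) = frv_term s \<union> frv_term t"
| "frv_form (Adj s t) = frv_term s \<union> frv_term t"
| "frv_form (Rel X ts) = insert X (\<Union> (set (map frv_term ts)))"
| "frv_form (Neg \<phi>) = frv_form \<phi>"
| "frv_form (Conj \<phi> \<psi>) = frv_form \<phi> \<union> frv_form \<psi>"
| "frv_form (Exists x \<phi>) = frv_form \<phi>"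
| "frv_form (Ifp i xs \<phi> ts) =
     (frv_form \<phi> - {(map fst xs, i)}) \<union> \<Union> (set (map frv_term ts))"

definition fpc_sentence :: "fpc_form \<Rightarrow> bool" where
  "fpc_sentence \<phi> \<longleftrightarrow> wf_form \<phi> \<and> fv_form \<phi> = {} \<and> frv_form \<phi> = {}"

primrec sort_dom :: "nat \<Rightarrow> sort \<Rightarrow> nat set" where
  "sort_dom n Vertex = {1..n}"
| "sort_dom n Number = {0..n}"

definition sorted_tuples :: "nat \<Rightarrow> sort list \<Rightarrow> nat list set" where
  "sorted_tuples n ss = {as. list_all2 (\<lambda>a s. a \<in> sort_dom n s) as ss}"

definition upd_tuple :: "(var \<Rightarrow> nat) \<Rightarrow> var list \<Rightarrow> nat list \<Rightarrow> var \<Rightarrow> nat" where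
  "upd_tuple \<alpha> xs as = (\<lambda>x. case map_of (zip xs as) x of Some a \<Rightarrow> a | None \<Rightarrow> \<alpha> x)"

text \<open>Union of the stages \<open>R\<^sub>0 = {}\<close>, \<open>R\<^sub>i\<^sub>+\<^sub>1 = R\<^sub>i \<union> F R\<^sub>i\<close>. Over a finite set of tuples the stages
  become stationary after finitely many steps.\<close>

definition ifp :: "('a set \<Rightarrow> 'a set) \<Rightarrow> 'a set" where
  "ifp F = (\<Union>i. ((\<lambda>R. R \<union> F R) ^^ i) {})"

primrec
  eval_term :: "graph \<Rightarrow> fpc_term \<Rightarrow> (var \<Rightarrow> nat) \<Rightarrow> (relvar \<Rightarrow> nat list set) \<Rightarrow> nat" and
  sat :: "graph \<Rightarrow> fpc_form \<Rightarrow> (var \<Rightarrow> nat) \<Rightarrow> (relvar \<Rightarrow> nat list set) \<Rightarrow> bool"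
where
  "eval_term G (Var x) \<alpha> \<rho> = \<alpha> x"
| "eval_term G (Count i \<phi>) \<alpha> \<rho> =
     card {a \<in> sort_dom (fst G) Vertex. sat G \<phi> (\<alpha>((Vertex, i) := a)) \<rho>}"
| "sat G (Equal s t) \<alpha> \<rho> \<longleftrightarrow> eval_term G s \<alpha> \<rho> = eval_term G t \<alpha> \<rho>"
| "sat G (Leq s t) \<alpha> \<rho> \<longleftrightarrow> eval_term G s \<alpha> \<rho> \<le> eval_term G t \<alpha> \<rho>"
| "sat G (Adj s t) \<alpha> \<rho> \<longleftrightarrow> {eval_term G s \<alpha> \<rho>, eval_term G t \<alpha> \<rho>} \<in> snd G"
| "sat G (Rel X ts) \<alpha> \<rho> \<longleftrightarrow> map (\<lambda>t. eval_term G t \<alpha> \<rho>) ts \<in> \<rho> X"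
| "sat G (Neg \<phi>) \<alpha> \<rho> \<longleftrightarrow> \<not> sat G \<phi> \<alpha> \<rho>"
| "sat G (Conj \<phi> \<psi>) \<alpha> \<rho> \<longleftrightarrow> sat G \<phi> \<alpha> \<rho> \<and> sat G \<psi> \<alpha> \<rho>"
| "sat G (Exists x \<phi>) \<alpha> \<rho> \<longleftrightarrow> (\<exists>a \<in> sort_dom (fst G) (fst x). sat G \<phi> (\<alpha>(x := a)) \<rho>)"
| "sat G (Ifp i xs \<phi> ts) \<alpha> \<rho> \<longleftrightarrow>
     map (\<lambda>t. eval_term G t \<alpha> \<rho>) ts \<in>
       ifp (\<lambda>R. {as \<in> sorted_tuples (fst G) (map fst xs).
                  sat G \<phi> (upd_tuple \<alpha> xs as) (\<rho>((map fst xs, i) := R))})"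

text \<open>The truth of a sentence does not depend on the assignments, so the ones chosen here are
  immaterial.\<close>

definition fpc_definable :: "graph set \<Rightarrow> bool" where
  "fpc_definable C \<longleftrightarrow>
     (\<exists>\<phi>. fpc_sentence \<phi> \<and> C = {G. is_graph G \<and> sat G \<phi> (\<lambda>_. 0) (\<lambda>_. {})})"


section \<open>Solvability\<close>

definition planted_clique_solvable_ptime ::
    "real \<Rightarrow> (nat \<Rightarrow> nat) \<Rightarrow> (nat \<Rightarrow> real) \<Rightarrow> bool" where
  "planted_clique_solvable_ptime p k \<epsilon> \<longleftrightarrow>
     (\<exists>C. ptime_decidable C \<and> solves_planted_clique p k \<epsilon> C)"

definition planted_clique_solvable_fpc ::
    "real \<Rightarrow> (nat \<Rightarrow> nat) \<Rightarrow> (nat \<Rightarrow> real) \<Rightarrow> bool" where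
  "planted_clique_solvable_fpc p k \<epsilon> \<longleftrightarrow>
     (\<exists>C. fpc_definable C \<and> solves_planted_clique p k \<epsilon> C)"

end

theory Submission
  imports Defs "HOL-Real_Asymp.Real_Asymp"
begin

text \<open>Fix seven vertices \<open>x\<^sub>1, \<dots>, x\<^sub>7\<close> and map every vertex \<open>v\<close> to the tuple of the numbers of common
  neighbours of \<open>v\<close> and \<open>x\<^sub>i\<close>. In a random graph two given vertices get the same tuple with
  probability \<open>O(n\<^sup>-\<^sup>5\<^sup>/\<^sup>2)\<close>, so with high probability the tuples are pairwise distinct and
  their lexicographic order is a linear order of the vertices, definable with the seven vertices as
  parameters. Over ordered graphs, fixed points simulate polynomial-time machines. The sentence
  says that there are seven vertices that induce a linear order and for which the machine accepts
  the graph presented in this order; the choice of the seven vertices is immaterial because the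
  given class is closed under isomorphism. The resulting class \<open>D\<close> is a subset of the given class
  \<open>C\<close>, so graphs with a planted clique are accepted with no greater probability than
  before, and nothing needs to be known about the order on them. On \<open>gnp n (1/2)\<close> only
  the graphs without such an order are lost.\<close>

section \<open>Anticoncentration of common neighbour counts\<close>

text \<open>Why seven parameters: the estimate for two vertices \<open>u\<close> and
  \<open>v\<close> only covers parameters different from both, so five of the seven are guaranteed
  to count. Each of these contributes a factor of order n^(-1/2), the largest point probability of a
  binomial distribution, and five is the least number of such factors that survives a union bound
  over n^2 pairs. The obstacle is dependence: all the counts share the edges at \<open>u\<close> and
  \<open>v\<close>. Those edges are fixed before the others; apart from an exponentially small
  exception, more than about a quarter of the vertices are then adjacent to exactly one of
  \<open>u\<close> and \<open>v\<close>. After that the edges at each parameter are fresh, and every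
  parameter costs its own factor. For p = 1/2 all of this is counting of edge sets. In the sentence,
  counting terms serve only to define the order; times and tape positions are tuples of vertices
  read as digits in base \<open>n\<close>. A tape cell is coded by a single digit, so its code must
  be less than \<open>n\<close>, which fails for finitely many \<open>n\<close> only.\<close>

lemma central_binomial_Suc:
  "Suc m * ((2 * Suc m) choose Suc m) = 2 * (2 * m + 1) * ((2 * m) choose m)"
proof -
  have a: "Suc m * (Suc (2 * m + 1) choose Suc m) = Suc (2 * m + 1) * ((2 * m + 1) choose m)"
    by (rule Suc_times_binomial)
  have b: "Suc m * (Suc (2 * m) choose Suc m) = Suc (2 * m) * ((2 * m) choose m)"
    by (rule Suc_times_binomial)
  have c: "(Suc (2 * m) choose Suc m) = (Suc (2 * m) choose m)"
    using binomial_symmetric[of "Suc m" "Suc (2 * m)"] by simp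
  have "Suc m * ((2 * Suc m) choose Suc m) = 2 * (Suc m * (Suc (2 * m) choose m))"
    using a by simp
  also have "\<dots> = 2 * (2 * m + 1) * ((2 * m) choose m)"
    using b c by (simp only:) simp
  finally show ?thesis .
qed

text \<open>Squaring keeps the induction inside \<open>nat\<close>. With the ratio of consecutive
  central binomial coefficients, the induction step comes down to (2m + 1)(2m + 3) \<le> (2m +
  2)^2.\<close>

lemma central_binomial_square_le: "((2 * m) choose m)\<^sup>2 * (2 * m + 1) \<le> 16 ^ m"
proof (induction m)
  case 0
  show ?case by simp
next
  case (Suc m)
  let ?c = "(2 * m) choose m" and ?c' = "(2 * Suc m) choose Suc m"
  have "(Suc m)\<^sup>2 * (?c'\<^sup>2 * (2 * Suc m + 1)) = (Suc m * ?c')\<^sup>2 * (2 * Suc m + 1)"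
    by (simp only: power_mult_distrib mult_ac)
  also have "\<dots> = (?c\<^sup>2 * (2 * m + 1)) * (4 * ((2 * m + 1) * (2 * m + 3)))"
    unfolding central_binomial_Suc by (simp add: power2_eq_square algebra_simps)
  also have "\<dots> \<le> 16 ^ m * (16 * (Suc m)\<^sup>2)"
    by (rule mult_le_mono[OF Suc]) (simp add: power2_eq_square algebra_simps)
  finally have "(Suc m)\<^sup>2 * (?c'\<^sup>2 * (2 * Suc m + 1)) \<le> (Suc m)\<^sup>2 * 16 ^ Suc m"
    by (simp only: power_Suc mult_ac)
  then show ?case by (rule mult_left_le_imp_le) simp
qed

lemma central_binomial_le: "real ((2 * m) choose m) \<le> 4 ^ m / sqrt (2 * m + 1)"
proof -
  have "real (((2 * m) choose m)\<^sup>2 * (2 * m + 1)) \<le> real (16 ^ m)"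
    using central_binomial_square_le[of m] by (subst of_nat_le_iff)
  moreover have "(16 :: real) ^ m = (4 ^ m)\<^sup>2"
    by (simp add: power2_eq_square flip: power_mult_distrib)
  ultimately have "(real ((2 * m) choose m) * sqrt (2 * m + 1))\<^sup>2 \<le> (4 ^ m)\<^sup>2"
    by (simp add: power_mult_distrib algebra_simps)
  then have "real ((2 * m) choose m) * sqrt (2 * m + 1) \<le> 4 ^ m"
    by (rule power2_le_imp_le) simp
  then show ?thesis by (simp add: pos_le_divide_eq)
qed

text \<open>The source of anticoncentration: no value of a fair binomial variable with
  \<open>s\<close> trials has probability above 1 / sqrt (s + 1). The middle coefficient is the
  largest; for odd \<open>s\<close> it is half of the central coefficient of the next row.\<close>

lemma binomial_le_sqrt: "real (s choose j) \<le> 2 ^ s / sqrt (s + 1)"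
proof -
  have "s choose j \<le> s choose (s div 2)" by (rule binomial_maximum)
  moreover have "real (s choose (s div 2)) \<le> 2 ^ s / sqrt (s + 1)"
  proof (cases "even s")
    case True
    then obtain m where m: "s = 2 * m" by (auto elim: evenE)
    then show ?thesis using central_binomial_le[of m] by (simp add: power_mult add.commute)
  next
    case False
    then obtain m where m: "s = 2 * m + 1" by (auto elim: oddE)
    have a: "Suc m * (Suc (2 * m + 1) choose Suc m) = Suc (2 * m + 1) * ((2 * m + 1) choose m)"
      by (rule Suc_times_binomial)
    also have "Suc (2 * m + 1) = 2 * Suc m" by simp
    finally have "Suc m * ((2 * Suc m) choose Suc m) = Suc m * (2 * ((2 * m + 1) choose m))"
      by (simp only: mult.left_commute mult.assoc)
    then have a: "((2 * Suc m) choose Suc m) = 2 * ((2 * m + 1) choose m)"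
      by (subst (asm) mult_cancel1) simp
    have "real (s choose (s div 2)) = real ((2 * Suc m) choose Suc m) / 2"
      unfolding m a by simp
    also have "\<dots> \<le> (4 ^ Suc m / sqrt (2 * Suc m + 1)) / 2"
      using central_binomial_le[of "Suc m"] by (intro divide_right_mono) auto
    also have "\<dots> = 2 ^ s / sqrt (2 * Suc m + 1)"
      by (simp add: m power_mult)
    also have "\<dots> \<le> 2 ^ s / sqrt (s + 1)"
      by (intro divide_left_mono) (auto simp: m)
    finally show ?thesis .
  qed
  ultimately show ?thesis by (meson of_nat_le_iff order_trans)
qed

text \<open>Complementing \<open>A\<close> on \<open>Q - P\<close> turns the equation into one that fixes the size of the
  part of \<open>A\<close> in the symmetric difference \<open>S\<close>.\<close>

lemma card_balanced_subsets_le: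
  assumes "finite W" "P \<subseteq> W" "Q \<subseteq> W"
  defines "S \<equiv> (P - Q) \<union> (Q - P)"
  shows "real (card {A \<in> Pow W. a + card (P \<inter> A) = b + card (Q \<inter> A)})
           \<le> 2 ^ card W / sqrt (card S + 1)"
proof -
  define F where "F = {A \<in> Pow W. a + card (P \<inter> A) = b + card (Q \<inter> A)}"
  \<comment> \<open>The equation for \<open>A\<close> is equivalent to a + card (A \<inter> (P - Q))
    + card ((Q - P) - A) = b + card (Q - P). If some \<open>A\<close> satisfies it, then
    \<open>a\<close> does not exceed the right-hand side, so the subtraction is not
    truncated.\<close>
  define j where "j = b + card (Q - P) - a"
  define g where "g = (\<lambda>A. (A - S, (A \<inter> (P - Q)) \<union> ((Q - P) - A)))"
  have fin: "finite P" "finite Q" "finite S"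
    using finite_subset[OF assms(2)] finite_subset[OF assms(3)] assms(1) by (auto simp: S_def)
  have "inj_on g F"
    by (rule inj_onI) (auto simp: g_def S_def F_def)
  moreover have "g ` F \<subseteq> Pow (W - S) \<times> {T. T \<subseteq> S \<and> card T = j}"
  proof clarify
    fix A X Y assume A: "A \<in> F" and g: "(X, Y) = g A"
    have "card (P \<inter> A) = card (P \<inter> Q \<inter> A) + card (A \<inter> (P - Q))"
      using fin by (subst card_Un_disjoint[symmetric]) (auto intro!: arg_cong[where f = card])
    moreover have "card (Q \<inter> A) = card (P \<inter> Q \<inter> A) + card (A \<inter> (Q - P))"
      using fin by (subst card_Un_disjoint[symmetric]) (auto intro!: arg_cong[where f = card])
    moreover have "card (Q - P) = card ((Q - P) - A) + card (A \<inter> (Q - P))"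
      using fin by (subst card_Un_disjoint[symmetric]) (auto intro!: arg_cong[where f = card])
    moreover have "card (A \<inter> (P - Q) \<union> ((Q - P) - A)) = card (A \<inter> (P - Q)) + card ((Q - P) - A)"
      using fin by (intro card_Un_disjoint) auto
    ultimately have "card (A \<inter> (P - Q) \<union> ((Q - P) - A)) = j"
      using A by (auto simp: F_def j_def)
    then show "X \<in> Pow (W - S) \<and> Y \<in> {T. T \<subseteq> S \<and> card T = j}"
      using A g by (auto simp: F_def g_def S_def)
  qed
  ultimately have "card F \<le> card (Pow (W - S) \<times> {T. T \<subseteq> S \<and> card T = j})"
    using fin assms(1) by (intro card_inj_on_le) auto
  also have "\<dots> = 2 ^ card (W - S) * (card S choose j)"
    using fin assms(1) by (simp add: card_cartesian_product card_Pow n_subsets)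
  finally have "real (card F) \<le> 2 ^ card (W - S) * real (card S choose j)"
    by (metis of_nat_le_iff of_nat_mult of_nat_numeral of_nat_power)
  also have "\<dots> \<le> 2 ^ card (W - S) * (2 ^ card S / sqrt (card S + 1))"
    by (intro mult_left_mono binomial_le_sqrt) auto
  also have "\<dots> = 2 ^ card W / sqrt (card S + 1)"
  proof -
    have "card W = card (W - S) + card S"
      using assms(1-3) fin(3) by (subst card_Un_disjoint[symmetric]) (auto simp: S_def intro!: arg_cong[where f = card])
    then show ?thesis by (simp add: power_add)
  qed
  finally show ?thesis unfolding F_def .
qed

text \<open>An exponential moment bound: give every subset \<open>A\<close> the weight 2^(-card A).
  All subsets together weigh (3/2)^(card W), and each small one weighs at least 2^(-a).\<close>

lemma card_small_subsets_le:
  assumes "finite W"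
  shows "real (card {A \<in> Pow W. card A \<le> a}) \<le> (3 / 2) ^ card W * 2 ^ a"
proof -
  have "real (card {A \<in> Pow W. card A \<le> a}) * (1 / 2) ^ a =
          (\<Sum>A\<in>{A \<in> Pow W. card A \<le> a}. (1 / 2) ^ a)"
    by simp
  also have "\<dots> \<le> (\<Sum>A\<in>{A \<in> Pow W. card A \<le> a}. (1 / 2 :: real) ^ card A)"
    by (intro sum_mono power_decreasing) auto
  also have "\<dots> \<le> (\<Sum>A\<in>Pow W. (1 / 2 :: real) ^ card A)"
    using assms by (intro sum_mono2) auto
  also have "\<dots> = (\<Prod>w\<in>W. 1 / 2 + 1)"
    using assms by (subst prod_add) auto
  also have "\<dots> = (3 / 2) ^ card W" by simp
  finally show ?thesis by (simp add: field_simps)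
qed

text \<open>The law of total probability for a uniform subset of \<open>E\<close>, in counting form.
  By \<open>inv\<close>, membership in \<open>A\<close> is settled by the part outside
  \<open>E'\<close>; by \<open>bound\<close>, given any such part, at most a fraction
  \<open>q\<close> of the choices on \<open>E'\<close> lead into \<open>B\<close>. Summing over the
  outer parts in \<open>A\<close> gives the claim.\<close>

lemma card_conditional_le:
  fixes q :: real
  assumes "finite E" "E' \<subseteq> E" "A \<subseteq> Pow E"
    and inv: "\<And>X Y. X \<subseteq> E - E' \<Longrightarrow> Y \<subseteq> E' \<Longrightarrow> X \<union> Y \<in> A \<longleftrightarrow> X \<in> A"
    and bound: "\<And>X. X \<in> A \<Longrightarrow> X \<subseteq> E - E' \<Longrightarrow> real (card {Y \<in> Pow E'. X \<union> Y \<in> B}) \<le> q * 2 ^ card E'"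
  shows "real (card (A \<inter> B)) \<le> q * card A"
proof -
  define A0 where "A0 = A \<inter> Pow (E - E')"
  have fin: "finite E'" "finite A0"
    using assms finite_subset by (auto simp: A0_def)
  have split: "Z = (Z - E') \<union> (Z \<inter> E')" for Z by auto
  have "bij_betw (\<lambda>(X, Y). X \<union> Y) (A0 \<times> Pow E') A"
  proof (rule bij_betw_byWitness[where f' = "\<lambda>Z. (Z - E', Z \<inter> E')"])
    show "(\<lambda>Z. (Z - E', Z \<inter> E')) ` A \<subseteq> A0 \<times> Pow E'"
    proof safe
      fix Z assume "Z \<in> A"
      then show "Z - E' \<in> A0"
        using assms(3) inv[of "Z - E'" "Z \<inter> E'"] split[of Z] by (auto simp: A0_def)
    qed
  qed (use inv in \<open>auto simp: A0_def\<close>)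
  then have cA: "card A = card A0 * 2 ^ card E'"
    using fin by (auto simp: bij_betw_same_card[symmetric] card_cartesian_product card_Pow)
  have "A \<inter> B \<subseteq> (\<Union>X\<in>A0. (\<lambda>Y. X \<union> Y) ` {Y \<in> Pow E'. X \<union> Y \<in> B})"
  proof
    fix Z assume Z: "Z \<in> A \<inter> B"
    then have "Z - E' \<in> A0"
      using assms(3) inv[of "Z - E'" "Z \<inter> E'"] split[of Z] by (auto simp: A0_def)
    then show "Z \<in> (\<Union>X\<in>A0. (\<lambda>Y. X \<union> Y) ` {Y \<in> Pow E'. X \<union> Y \<in> B})"
      using Z split[of Z] by (intro UN_I[of "Z - E'"] image_eqI[of _ _ "Z \<inter> E'"]) auto
  qed
  then have "card (A \<inter> B) \<le> card (\<Union>X\<in>A0. (\<lambda>Y. X \<union> Y) ` {Y \<in> Pow E'. X \<union> Y \<in> B})"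
    using fin by (intro card_mono) auto
  also have "\<dots> \<le> (\<Sum>X\<in>A0. card ((\<lambda>Y. X \<union> Y) ` {Y \<in> Pow E'. X \<union> Y \<in> B}))"
    using fin by (intro card_UN_le)
  also have "\<dots> \<le> (\<Sum>X\<in>A0. card {Y \<in> Pow E'. X \<union> Y \<in> B})"
    using fin by (intro sum_mono card_image_le) auto
  finally have "real (card (A \<inter> B)) \<le> (\<Sum>X\<in>A0. real (card {Y \<in> Pow E'. X \<union> Y \<in> B}))"
    by (simp flip: of_nat_sum)
  also have "\<dots> \<le> (\<Sum>X\<in>A0. q * 2 ^ card E')"
    by (intro sum_mono bound) (auto simp: A0_def)
  also have "\<dots> = q * card A" by (simp add: cA)
  finally show ?thesis .
qed

section \<open>Separating two vertices by common neighbour counts\<close>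

definition common_neighbours :: "graph \<Rightarrow> nat \<Rightarrow> nat \<Rightarrow> nat" where
  "common_neighbours G x y = card {w \<in> {1..fst G}. {w, x} \<in> snd G \<and> {w, y} \<in> snd G}"

text \<open>The two summands belong to two cases. \<open>S Z\<close> collects the vertices of
  \<open>W\<close> adjacent to exactly one of \<open>u\<close> and \<open>v\<close>; the first
  summand bounds the case that it has at most m div 4 elements. Otherwise the edges from
  \<open>W\<close> to each \<open>i\<close> in \<open>I\<close> are exposed in turn, and each
  \<open>i\<close> has equal counts with \<open>u\<close> and \<open>v\<close> in at most a fraction
  1 / sqrt (m div 4 + 1) of the choices. As \<open>W\<close> avoids \<open>I\<close>,
  \<open>u\<close> and \<open>v\<close>, the stars of different centres share no edge.\<close>

lemma card_indistinguishable_pair_le: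
  fixes n :: nat and I :: "nat set"
  defines "V \<equiv> {1..n}"
  defines "E \<equiv> nsets V 2"
  assumes u: "u \<in> V" and v: "v \<in> V" and uv: "u \<noteq> v" and I: "I \<subseteq> V" "u \<notin> I" "v \<notin> I"
  defines "W \<equiv> V - (I \<union> {u, v})"
  defines "m \<equiv> card W"
  shows "real (card {Z \<in> Pow E. \<forall>i\<in>I. common_neighbours (n, Z) u i = common_neighbours (n, Z) v i})
     \<le> 2 ^ card E * ((3 / 4) ^ m * 2 ^ (m div 4) + (1 / sqrt (m div 4 + 1)) ^ card I)"
proof -
  define S where "S = (\<lambda>Z. {w \<in> W. ({w, u} \<in> Z) \<noteq> ({w, v} \<in> Z)})"
  define D where "D = (\<lambda>J. {Z \<in> Pow E. m div 4 < card (S Z) \<and>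
     (\<forall>i\<in>J. common_neighbours (n, Z) u i = common_neighbours (n, Z) v i)})"
  define q where "q = 1 / sqrt (m div 4 + 1)"
  define star where "star = (\<lambda>x. (\<lambda>w. {w, x}) ` W)"
  have fin: "finite V" "finite E" "finite W" "finite I"
    using I finite_subset by (auto simp: V_def E_def W_def finite_imp_finite_nsets)
  have star_E: "star x \<subseteq> E" if "x \<in> V - W" for x
    using that by (auto simp: star_def E_def W_def)
  have card_star: "card (star x) = m" if "x \<notin> W" for x
    unfolding star_def m_def using that
    by (intro card_image inj_onI) (auto simp: doubleton_eq_iff)
  have mem_star: "{w, y} \<in> star x \<longleftrightarrow> y = x \<and> w \<in> W" if "x \<notin> W" "y \<notin> W" for w x y
    using that by (auto simp: star_def doubleton_eq_iff)
  have notW: "u \<notin> W" "v \<notin> W" "\<And>i. i \<in> I \<Longrightarrow> i \<notin> W" by (auto simp: W_def)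
  \<comment> \<open>Everything except the edges between \<open>v\<close> and \<open>W\<close> is
    held fixed. Distinct choices of these edges give distinct sets \<open>S\<close>, so small
    \<open>S\<close> are no more frequent than small subsets of \<open>W\<close>. Dividing (3/2)^m *
    2^(m div 4) by 2^m yields the stated fraction.\<close>
  have small: "real (card (Pow E \<inter> {Z. card (S Z) \<le> m div 4})) \<le>
      ((3 / 4) ^ m * 2 ^ (m div 4)) * card (Pow E)"
  proof (rule card_conditional_le[where E = E and E' = "star v"])
    fix X assume X: "X \<subseteq> E - star v"
    define U where "U = {w \<in> W. {w, u} \<in> X}"
    define h where "h = (\<lambda>Y. {w \<in> W. (w \<in> U) \<noteq> ({w, v} \<in> Y)})"
    have S: "S (X \<union> Y) = h Y" if "Y \<subseteq> star v" for Y
    proof -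
      have "({w, u} \<in> X \<union> Y) = (w \<in> U)" "({w, v} \<in> X \<union> Y) = ({w, v} \<in> Y)" if "w \<in> W" for w
        using that X \<open>Y \<subseteq> star v\<close> mem_star[of v u w] mem_star[of v v w] notW uv
        by (auto simp: U_def)
      then show ?thesis unfolding S_def h_def by blast
    qed
    have "inj_on h (Pow (star v))"
    proof (rule inj_onI)
      fix Y Y' assume Y: "Y \<in> Pow (star v)" "Y' \<in> Pow (star v)" "h Y = h Y'"
      have "{w, v} \<in> Y \<longleftrightarrow> {w, v} \<in> Y'" if "w \<in> W" for w
        using Y(3) that unfolding h_def by blast
      then show "Y = Y'" using Y by (auto simp: star_def)
    qed
    then have "card {Y \<in> Pow (star v). X \<union> Y \<in> {Z. card (S Z) \<le> m div 4}} \<le>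
        card {A \<in> Pow W. card A \<le> m div 4}"
      using fin by (intro card_inj_on_le[where f = h]) (auto simp: S inj_on_def, auto simp: h_def)
    also have "real (card {A \<in> Pow W. card A \<le> m div 4}) \<le> (3 / 2) ^ m * 2 ^ (m div 4)"
      using card_small_subsets_le[OF fin(3)] by (simp add: m_def)
    also have "\<dots> = (3 / 4) ^ m * 2 ^ (m div 4) * 2 ^ card (star v)"
      using notW by (simp add: card_star flip: power_mult_distrib)
    finally show "real (card {Y \<in> Pow (star v). X \<union> Y \<in> {Z. card (S Z) \<le> m div 4}})
      \<le> (3 / 4) ^ m * 2 ^ (m div 4) * 2 ^ card (star v)" by simp
  qed (use fin star_E[of v] v notW in auto)
  \<comment> \<open>Parameters are added one at a time, each at the price of a factor
    \<open>q\<close>. The condition that \<open>S\<close> is large is carried along in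
    \<open>D\<close>, because every further factor needs it.\<close>
  have D: "real (card (D J)) \<le> q ^ card J * 2 ^ card E" if "finite J" "J \<subseteq> I" for J
    using that
  proof (induction J)
    case empty
    have "card (D {}) \<le> card (Pow E)" using fin by (intro card_mono) (auto simp: D_def)
    then show ?case using fin by (simp add: card_Pow flip: of_nat_le_iff)
  next
    case (insert i J)
    have i: "i \<in> V - W" "i \<in> I" "i \<noteq> u" "i \<noteq> v" using insert I by (auto simp: W_def)
    \<comment> \<open>An edge at \<open>u\<close>, \<open>v\<close> or a parameter other than
      \<open>i\<close>, even one that ends in \<open>i\<close>, is outside \<open>star i\<close>,
      whose edges join \<open>i\<close> to \<open>W\<close>. Hence \<open>S\<close> and the earlier
      counts do not change when \<open>star i\<close> is exposed.\<close>
    have nbrs: "{w, y} \<in> X \<union> Y \<longleftrightarrow> {w, y} \<in> X" if "Y \<subseteq> star i" "y \<in> insert u (insert v I)" "y \<noteq> i" for w y X Y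
      using mem_star[of i y w] that i notW by auto
    have S: "S (X \<union> Y) = S X" if "Y \<subseteq> star i" for X Y
      unfolding S_def using nbrs[OF that, of u] nbrs[OF that, of v] i by auto
    have C: "common_neighbours (n, X \<union> Y) x j = common_neighbours (n, X) x j"
      if "Y \<subseteq> star i" "j \<in> J" "x \<in> {u, v}" for X Y x j
    proof -
      have "j \<in> I" "j \<noteq> i" using that insert by auto
      then show ?thesis unfolding common_neighbours_def
        using nbrs[OF that(1), of x] nbrs[OF that(1), of j] i that(3) by auto
    qed
    have "real (card (D J \<inter> {Z. common_neighbours (n, Z) u i = common_neighbours (n, Z) v i}))
            \<le> q * card (D J)"
    proof (rule card_conditional_le[where E = E and E' = "star i"])
      show "(X \<union> Y \<in> D J) = (X \<in> D J)" if "X \<subseteq> E - star i" "Y \<subseteq> star i" for X Y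
        using that star_E[OF i(1)] unfolding D_def by (auto simp: S C)
    next
      fix X assume X: "X \<in> D J" "X \<subseteq> E - star i"
      define N where "N = (\<lambda>x. {w \<in> W. {w, x} \<in> X})"
      define c where "c = (\<lambda>x. card {w \<in> V - W. {w, x} \<in> X \<and> {w, i} \<in> X})"
      define h where "h = (\<lambda>Y. {w \<in> W. {w, i} \<in> Y})"
      \<comment> \<open>Witnesses outside \<open>W\<close> contribute a constant fixed by
        \<open>X\<close>; inside \<open>W\<close> the count is the intersection of the neighbourhood
        \<open>N x\<close> with the subset \<open>h Y\<close> chosen by the new edges. Equality of
        the two counts is therefore a balance condition on \<open>h Y\<close>.\<close>
      have eq: "common_neighbours (n, X \<union> Y) x i = c x + card (N x \<inter> h Y)"
        if "Y \<subseteq> star i" "x \<in> {u, v}" for x Y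
      proof -
        have "{w \<in> {1..n}. {w, x} \<in> X \<union> Y \<and> {w, i} \<in> X \<union> Y} =
            {w \<in> V - W. {w, x} \<in> X \<and> {w, i} \<in> X} \<union> (N x \<inter> h Y)"
          using that nbrs[OF that(1), of x] mem_star[of i i] X(2) i
          unfolding V_def[symmetric] N_def h_def W_def by blast
        then show ?thesis unfolding common_neighbours_def c_def fst_conv snd_conv
          using fin by (subst card_Un_disjoint[symmetric]) (auto simp: N_def)
      qed
      have "inj_on h (Pow (star i))"
      proof (rule inj_onI)
        fix Y Y' assume Y: "Y \<in> Pow (star i)" "Y' \<in> Pow (star i)" "h Y = h Y'"
        have "{w, i} \<in> Y \<longleftrightarrow> {w, i} \<in> Y'" if "w \<in> W" for w
          using Y(3) that unfolding h_def by blast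
        then show "Y = Y'" using Y by (auto simp: star_def)
      qed
      then have "card {Y \<in> Pow (star i). X \<union> Y \<in> {Z. common_neighbours (n, Z) u i = common_neighbours (n, Z) v i}}
          \<le> card {A \<in> Pow W. c u + card (N u \<inter> A) = c v + card (N v \<inter> A)}"
        using fin by (intro card_inj_on_le[where f = h]) (auto simp: eq inj_on_def, auto simp: h_def)
      also have "real \<dots> \<le> 2 ^ card W / sqrt (card ((N u - N v) \<union> (N v - N u)) + 1)"
        using fin by (intro card_balanced_subsets_le) (auto simp: N_def)
      \<comment> \<open>The set on which the balance condition depends is exactly
        \<open>S X\<close>, and membership in \<open>D J\<close> guarantees its size.\<close>
      also have "(N u - N v) \<union> (N v - N u) = S X"
        by (auto simp: N_def S_def)
      also have "2 ^ card W / sqrt (card (S X) + 1) \<le> 2 ^ card W / sqrt (m div 4 + 1)"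
        using X(1) by (intro divide_left_mono) (auto simp: D_def)
      also have "\<dots> = q * 2 ^ card (star i)"
        using i by (simp add: card_star q_def m_def)
      finally show "real (card {Y \<in> Pow (star i). X \<union> Y \<in> {Z. common_neighbours (n, Z) u i = common_neighbours (n, Z) v i}})
          \<le> q * 2 ^ card (star i)" by simp
    qed (use fin star_E[OF i(1)] in \<open>auto simp: D_def\<close>)
    also have "D J \<inter> {Z. common_neighbours (n, Z) u i = common_neighbours (n, Z) v i} = D (insert i J)"
      by (auto simp: D_def)
    finally have "real (card (D (insert i J))) \<le> q * card (D J)" .
    also have "\<dots> \<le> q * (q ^ card J * 2 ^ card E)"
      using insert by (intro mult_left_mono) (auto simp: q_def)
    finally show ?case using insert by simp
  qed
  have "card {Z \<in> Pow E. \<forall>i\<in>I. common_neighbours (n, Z) u i = common_neighbours (n, Z) v i} \<le>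
      card ((Pow E \<inter> {Z. card (S Z) \<le> m div 4}) \<union> D I)"
    using fin by (intro card_mono) (auto simp: D_def)
  also have "\<dots> \<le> card (Pow E \<inter> {Z. card (S Z) \<le> m div 4}) + card (D I)"
    by (rule card_Un_le)
  finally have "real (card {Z \<in> Pow E. \<forall>i\<in>I. common_neighbours (n, Z) u i = common_neighbours (n, Z) v i})
     \<le> real (card (Pow E \<inter> {Z. card (S Z) \<le> m div 4})) + real (card (D I))"
    by linarith
  also have "\<dots> \<le> ((3 / 4) ^ m * 2 ^ (m div 4)) * 2 ^ card E + q ^ card I * 2 ^ card E"
    using small D[of I] fin by (intro add_mono) (auto simp: card_Pow)
  finally show ?thesis by (simp add: q_def algebra_simps)
qed

section \<open>Seven parameters identify all vertices with high probability\<close>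

definition neighbour_profile :: "graph \<Rightarrow> nat list \<Rightarrow> nat \<Rightarrow> nat list" where
  "neighbour_profile G xs v = map (common_neighbours G v) xs"

definition identifiable :: "nat \<Rightarrow> graph \<Rightarrow> bool" where
  "identifiable l G \<longleftrightarrow> (\<exists>xs. length xs = l \<and> set xs \<subseteq> {1..fst G} \<and>
     inj_on (neighbour_profile G xs) {1..fst G})"

text \<open>At p = 1/2 all edge sets are equally likely, so the bounds on numbers of edge sets
  become bounds on probabilities.\<close>

lemma gnp_half: "gnp n (1 / 2) = map_pmf (Pair n) (pmf_of_set (Pow (nsets {1..n} 2)))"
proof -
  have "gnp n (1 / 2) = map_pmf (Pair n) (map_pmf (\<lambda>f. {e \<in> nsets {1..n} 2. f e})
     (Pi_pmf (nsets {1..n} 2) False (\<lambda>_. bernoulli_pmf (1 / 2))))"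
    unfolding gnp_def by (simp add: pmf.map_comp o_def)
  then show ?thesis
    by (simp add: pmf_of_set_Pow_conv_bernoulli finite_imp_finite_nsets)
qed

lemma prob_gnp_half:
  "measure_pmf.prob (gnp n (1 / 2)) X =
     card {Z \<in> Pow (nsets {1..n} 2). (n, Z) \<in> X} / 2 ^ card (nsets {1..n} 2)"
proof -
  have fin: "finite (nsets {1..n} 2)" by (simp add: finite_imp_finite_nsets)
  have "Pow (nsets {1..n} 2) \<inter> Pair n -` X = {Z \<in> Pow (nsets {1..n} 2). (n, Z) \<in> X}" by auto
  then show ?thesis using fin
    by (simp add: gnp_half measure_pmf_of_set Pow_not_empty card_Pow del: card_nsets)
qed

text \<open>The parameters are the vertices 1 to 7. Those equal to \<open>u\<close> or
  \<open>v\<close> are dropped, which leaves at least five. Parameters and pair together occupy at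
  most nine vertices, hence \<open>n - 9\<close>; \<open>b\<close> replaces m div 4 by a bound that
  is the same for all pairs.\<close>

lemma card_same_profile_le:
  fixes n :: nat
  defines "E \<equiv> nsets {1..n} 2" and "b \<equiv> (n - 9) div 4"
  assumes n: "9 \<le> n" and u: "u \<in> {1..n}" and v: "v \<in> {1..n}" and uv: "u \<noteq> v"
  shows "real (card {Z \<in> Pow E. neighbour_profile (n, Z) [1..<8] u = neighbour_profile (n, Z) [1..<8] v})
     \<le> 2 ^ card E * ((2 / 3) ^ b + (1 / sqrt (b + 1)) ^ 5)"
proof -
  define I where "I = {1..<8} - {u, v}"
  define m where "m = card ({1..n} - (I \<union> {u, v}))"
  have I: "I \<subseteq> {1..n}" "u \<notin> I" "v \<notin> I" "finite I" using n by (auto simp: I_def)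
  have "card {1..<8::nat} - card {u, v} \<le> card I"
    unfolding I_def by (rule diff_card_le_card_Diff) auto
  then have cI: "5 \<le> card I" using uv by simp
  have "card (I \<union> {u, v}) \<le> card ({1..<8::nat} \<union> {u, v})"
    by (intro card_mono) (auto simp: I_def)
  also have "\<dots> \<le> card {1..<8::nat} + card {u, v}" by (rule card_Un_le)
  finally have "card (I \<union> {u, v}) \<le> 9" using uv by simp
  moreover have "m = n - card (I \<union> {u, v})"
    unfolding m_def using I u v by (subst card_Diff_subset) auto
  ultimately have b: "b \<le> m div 4" unfolding b_def by (intro div_le_mono) simp
  have "real (card {Z \<in> Pow E. neighbour_profile (n, Z) [1..<8] u = neighbour_profile (n, Z) [1..<8] v}) \<le>
      real (card {Z \<in> Pow E. \<forall>i\<in>I. common_neighbours (n, Z) u i = common_neighbours (n, Z) v i})"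
    unfolding of_nat_le_iff E_def using finite_imp_finite_nsets[of "{1..n}" 2]
    by (intro card_mono) (auto simp: neighbour_profile_def I_def)
  also have "\<dots> \<le> 2 ^ card E * ((3 / 4) ^ m * 2 ^ (m div 4) + (1 / sqrt (m div 4 + 1)) ^ card I)"
    using card_indistinguishable_pair_le[OF u v uv I(1-3)] unfolding E_def m_def .
  also have "\<dots> \<le> 2 ^ card E * ((2 / 3) ^ b + (1 / sqrt (b + 1)) ^ 5)"
  proof (intro mult_left_mono add_mono)
    \<comment> \<open>Each unit of m div 4 accounts for four factors 3/4 and one factor 2, that is
      for 81/128, which is rounded up to 2/3.\<close>
    have "(3 / 4 :: real) ^ m * 2 ^ (m div 4) \<le> (3 / 4) ^ (4 * (m div 4)) * 2 ^ (m div 4)"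
      by (intro mult_right_mono power_decreasing) auto
    also have "\<dots> = (81 / 128) ^ (m div 4)"
      by (simp add: power_mult power4_eq_xxxx flip: power_mult_distrib)
    also have "\<dots> \<le> (2 / 3) ^ (m div 4)" by (intro power_mono) auto
    also have "\<dots> \<le> (2 / 3) ^ b" using b by (intro power_decreasing) auto
    finally show "(3 / 4 :: real) ^ m * 2 ^ (m div 4) \<le> (2 / 3) ^ b" .
    have "(1 / sqrt (m div 4 + 1)) ^ card I \<le> (1 / sqrt (m div 4 + 1)) ^ 5"
      using cI by (intro power_decreasing) auto
    also have "\<dots> \<le> (1 / sqrt (b + 1)) ^ 5"
      using b by (intro power_mono divide_left_mono) auto
    finally show "(1 / sqrt (m div 4 + 1)) ^ card I \<le> (1 / sqrt (b + 1)) ^ 5" .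
  qed auto
  finally show ?thesis .
qed

lemma prob_not_identifiable_tendsto:
  "(\<lambda>n. measure_pmf.prob (gnp n (1 / 2)) {G. \<not> identifiable 7 G}) \<longlonglongrightarrow> 0"
proof -
  \<comment> \<open>The union bound, with the number of pairs estimated through n \<le> 4b + 13 for
    b = (n - 9) div 4. As a function of \<open>b\<close> alone it is free of integer division; it
    decays like b^2 * b^(-5/2).\<close>
  define F where "F = (\<lambda>b::nat. (4 * real b + 13)\<^sup>2 * ((2 / 3) ^ b + (1 / sqrt (b + 1)) ^ 5))"
  have "F \<longlonglongrightarrow> 0" unfolding F_def by real_asymp
  moreover have "filterlim (\<lambda>n::nat. (n - 9) div 4) sequentially sequentially"
    unfolding filterlim_at_top eventually_sequentially
  proof
    fix N :: nat
    show "\<exists>M. \<forall>n\<ge>M. N \<le> (n - 9) div 4" by (rule exI[of _ "4 * N + 9"]) presburger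
  qed
  ultimately have lim: "(\<lambda>n. F ((n - 9) div 4)) \<longlonglongrightarrow> 0" by (rule filterlim_compose)
  have ub: "\<forall>\<^sub>F n in sequentially. measure_pmf.prob (gnp n (1 / 2)) {G. \<not> identifiable 7 G} \<le> F ((n - 9) div 4)"
  proof (rule eventually_sequentiallyI[of 9])
    fix n :: nat assume n: "9 \<le> n"
    define E where "E = nsets {1..n} 2"
    define b where "b = (n - 9) div 4"
    define B where "B = (\<lambda>(u, v). {Z \<in> Pow E. neighbour_profile (n, Z) [1..<8] u = neighbour_profile (n, Z) [1..<8] v})"
    define U where "U = {1..n} \<times> {1..n} - Id"
    have fin: "finite E" "finite U" by (auto simp: E_def U_def finite_imp_finite_nsets)
    have "{Z \<in> Pow E. (n, Z) \<in> {G. \<not> identifiable 7 G}} \<subseteq> (\<Union>p\<in>U. B p)"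
    proof
      fix Z assume Z: "Z \<in> {Z \<in> Pow E. (n, Z) \<in> {G. \<not> identifiable 7 G}}"
      then have "\<not> inj_on (neighbour_profile (n, Z) [1..<8]) {1..n}"
        using n unfolding identifiable_def by (auto dest!: spec[of _ "[1..<8]"])
      then show "Z \<in> (\<Union>p\<in>U. B p)" using Z unfolding inj_on_def U_def B_def by auto
    qed
    then have "card {Z \<in> Pow E. (n, Z) \<in> {G. \<not> identifiable 7 G}} \<le> card (\<Union>p\<in>U. B p)"
      using fin by (intro card_mono) (auto simp: B_def)
    also have "\<dots> \<le> (\<Sum>p\<in>U. card (B p))" using fin by (intro card_UN_le)
    finally have "real (card {Z \<in> Pow E. (n, Z) \<in> {G. \<not> identifiable 7 G}}) \<le> (\<Sum>p\<in>U. real (card (B p)))"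
      by (simp flip: of_nat_sum)
    also have "\<dots> \<le> (\<Sum>p\<in>U. 2 ^ card E * ((2 / 3) ^ b + (1 / sqrt (b + 1)) ^ 5))"
    proof (intro sum_mono)
      fix p assume p: "p \<in> U"
      show "real (card (B p)) \<le> 2 ^ card E * ((2 / 3) ^ b + (1 / sqrt (b + 1)) ^ 5)"
        unfolding B_def E_def b_def split_def using p
        by (intro card_same_profile_le n) (auto simp: U_def)
    qed
    also have "\<dots> = card U * (2 ^ card E * ((2 / 3) ^ b + (1 / sqrt (b + 1)) ^ 5))" by simp
    also have "\<dots> \<le> (4 * real b + 13)\<^sup>2 * (2 ^ card E * ((2 / 3) ^ b + (1 / sqrt (b + 1)) ^ 5))"
    proof (intro mult_right_mono)
      have "card U \<le> card ({1..n} \<times> {1..n})" unfolding U_def by (intro card_mono) auto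
      also have "\<dots> = n\<^sup>2" by (simp add: power2_eq_square)
      finally have "real (card U) \<le> (real n)\<^sup>2" by (simp flip: of_nat_power)
      also have "n \<le> 4 * b + 13" unfolding b_def using n by presburger
      then have "(real n)\<^sup>2 \<le> (4 * real b + 13)\<^sup>2" by (intro power_mono) auto
      finally show "real (card U) \<le> (4 * real b + 13)\<^sup>2" .
    qed auto
    finally show "measure_pmf.prob (gnp n (1 / 2)) {G. \<not> identifiable 7 G} \<le> F ((n - 9) div 4)"
      unfolding prob_gnp_half F_def E_def[symmetric] b_def[symmetric]
      by (simp add: field_simps)
  qed
  show ?thesis by (rule tendsto_sandwich[OF _ ub tendsto_const lim]) simp
qed

section \<open>Base-\<open>b\<close> values of tuples\<close>

text \<open>The most significant digit comes first, so among lists of equal length with digits below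
  \<open>b\<close> the order of the values is the lexicographic order. It serves twice: in base n +
  1 for tuples of neighbour counts, which range from 0 to \<open>n\<close>, and in base
  \<open>n\<close> for tuples of vertices that represent times and tape positions.\<close>

primrec base_val :: "nat \<Rightarrow> nat list \<Rightarrow> nat" where
  "base_val b [] = 0"
| "base_val b (x # xs) = x * b ^ length xs + base_val b xs"

lemma base_val_less: "set xs \<subseteq> {..<b} \<Longrightarrow> base_val b xs < b ^ length xs"
proof (induction xs)
  case (Cons x xs)
  then have "base_val b (x # xs) < x * b ^ length xs + b ^ length xs" by simp
  also have "\<dots> = Suc x * b ^ length xs" by simp
  also have "\<dots> \<le> b * b ^ length xs" using Cons by (intro mult_le_mono1) auto
  finally show ?case by simp
qed simp

lemma mult_add_less_mult_add_iff:
  fixes x y p :: nat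
  assumes "i < p" "j < p"
  shows "x * p + i < y * p + j \<longleftrightarrow> x < y \<or> x = y \<and> i < j"
proof -
  have *: "x * p + i < y * p + j" if "x < y" "i < p" for x y i j
  proof -
    have "x * p + i < Suc x * p" using that by simp
    also have "\<dots> \<le> y * p" using that by (intro mult_le_mono1) simp
    finally show ?thesis by simp
  qed
  show ?thesis using *[of x y i j] *[of y x j i] assms by (cases x y rule: linorder_cases) auto
qed

text \<open>The tails are less than the weight of the leading digit and so decide only in case of a
  tie. This is the recursion of \<open>LexLess\<close>.\<close>

lemma base_val_Cons_less_iff:
  assumes "length xs = length ys" "set xs \<subseteq> {..<b}" "set ys \<subseteq> {..<b}"
  shows "base_val b (x # xs) < base_val b (y # ys) \<longleftrightarrow>
     x < y \<or> x = y \<and> base_val b xs < base_val b ys"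
  using base_val_less[of xs b] base_val_less[of ys b] assms
    mult_add_less_mult_add_iff[of "base_val b xs" "b ^ length xs" "base_val b ys" x y]
  by simp

lemma base_val_inj:
  "length xs = length ys \<Longrightarrow> set xs \<subseteq> {..<b} \<Longrightarrow> set ys \<subseteq> {..<b} \<Longrightarrow>
     base_val b xs = base_val b ys \<longleftrightarrow> xs = ys"
proof (induction xs ys rule: list_induct2)
  case (Cons x xs y ys)
  have "base_val b (x # xs) = base_val b (y # ys) \<longleftrightarrow> x = y \<and> base_val b xs = base_val b ys"
    using base_val_Cons_less_iff[of xs ys b x y] base_val_Cons_less_iff[of ys xs b y x] Cons
    by (metis insert_subset linorder_neqE_nat list.simps(15) nat_neq_iff)
  then show ?case using Cons by simp
qed simp

lemma base_val_eq_0_iff: "0 < b \<Longrightarrow> base_val b xs = 0 \<longleftrightarrow> (\<forall>x\<in>set xs. x = 0)"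
  by (induction xs) auto

lemma base_val_eq_max_iff:
  "set xs \<subseteq> {..<b} \<Longrightarrow> Suc (base_val b xs) = b ^ length xs \<longleftrightarrow> (\<forall>x\<in>set xs. Suc x = b)"
proof (induction xs)
  case (Cons x xs)
  let ?p = "b ^ length xs"
  have xs: "base_val b xs < ?p" using Cons by (intro base_val_less) simp
  have "Suc (base_val b (x # xs)) = b ^ length (x # xs) \<longleftrightarrow>
      x * ?p + Suc (base_val b xs) = b * ?p" by simp
  also have "\<dots> \<longleftrightarrow> Suc x = b \<and> Suc (base_val b xs) = ?p"
  proof
    assume eq: "x * ?p + Suc (base_val b xs) = b * ?p"
    have "Suc x = b"
    proof (rule ccontr)
      assume "Suc x \<noteq> b"
      then have "Suc (Suc x) * ?p \<le> b * ?p" using Cons.prems by (intro mult_le_mono1) auto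
      then show False using eq xs by simp
    qed
    then show "Suc x = b \<and> Suc (base_val b xs) = ?p" using eq by auto
  qed auto
  finally show ?case using Cons by simp
qed simp

text \<open>Adding 1 either stays within the tail or carries: the tail turns from all maximal digits
  to all zeros and the leading digit grows by 1. These are the two disjuncts of
  \<open>SuccTuple\<close>.\<close>

lemma base_val_Cons_eq_Suc_iff:
  assumes "length xs = length ys" "set xs \<subseteq> {..<b}" "set ys \<subseteq> {..<b}" "0 < b"
  shows "base_val b (y # ys) = Suc (base_val b (x # xs)) \<longleftrightarrow>
     x = y \<and> base_val b ys = Suc (base_val b xs) \<or>
     y = Suc x \<and> (\<forall>d\<in>set xs. Suc d = b) \<and> (\<forall>d\<in>set ys. d = 0)"
proof -
  let ?p = "b ^ length ys" and ?i = "base_val b xs" and ?j = "base_val b ys"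
  have lt: "?i < ?p" "?j < ?p" using base_val_less[of xs b] base_val_less[of ys b] assms by auto
  have "y * ?p + ?j = Suc (x * ?p + ?i) \<longleftrightarrow>
      x = y \<and> ?j = Suc ?i \<or> y = Suc x \<and> Suc ?i = ?p \<and> ?j = 0"
  proof
    assume eq: "y * ?p + ?j = Suc (x * ?p + ?i)"
    have "x \<le> y"
    proof (rule ccontr)
      assume "\<not> x \<le> y"
      then have "Suc y * ?p \<le> x * ?p" by (intro mult_le_mono1) simp
      then show False using eq lt by simp
    qed
    moreover have "y \<le> Suc x"
    proof (rule ccontr)
      assume "\<not> y \<le> Suc x"
      then have "Suc (Suc x) * ?p \<le> y * ?p" by (intro mult_le_mono1) simp
      then show False using eq lt by simp
    qed
    ultimately have "y = x \<or> y = Suc x" by auto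
    then show "x = y \<and> ?j = Suc ?i \<or> y = Suc x \<and> Suc ?i = ?p \<and> ?j = 0"
      using eq lt by auto
  qed auto
  moreover have "Suc ?i = ?p \<longleftrightarrow> (\<forall>d\<in>set xs. Suc d = b)"
    using base_val_eq_max_iff[of xs b] assms by simp
  ultimately show ?thesis using assms base_val_eq_0_iff[of b ys] by simp
qed

lemma base_val_surj:
  "k < b ^ l \<Longrightarrow> \<exists>xs. length xs = l \<and> set xs \<subseteq> {..<b} \<and> base_val b xs = k"
proof (induction l arbitrary: k)
  case (Suc l)
  have "b ^ l > 0" using Suc.prems by (cases "b ^ l = 0") auto
  then obtain xs where xs: "length xs = l" "set xs \<subseteq> {..<b}" "base_val b xs = k mod b ^ l"
    using Suc.IH[of "k mod b ^ l"] by auto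
  have "k div b ^ l < b"
    using Suc.prems by (simp add: less_mult_imp_div_less)
  moreover have "base_val b (k div b ^ l # xs) = k"
    unfolding base_val.simps xs by (rule div_mult_mod_eq)
  ultimately show ?case using xs by (intro exI[of _ "k div b ^ l # xs"]) simp
qed simp

lemma base_val_append:
  "base_val b (xs @ ys) = base_val b xs * b ^ length ys + base_val b ys"
  by (induction xs) (auto simp: power_add algebra_simps)

text \<open>The cells of the block of length \<open>n\<^sup>2\<close> that starts at \<open>n\<^sup>e\<^sup>+\<^sup>2\<close> are the digit lists
  starting with \<open>1, 0, \<dots>, 0\<close>, and the last two digits run through all pairs in row order.\<close>

lemma base_val_block_iff:
  assumes "x < n" "y < n" "w < n" "set m \<subseteq> {..<n}" "1 < n"
  shows "n ^ (length m + 2) \<le> base_val n (x # m @ [y, w]) \<and>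
      base_val n (x # m @ [y, w]) < n ^ (length m + 2) + n * n \<longleftrightarrow> x = 1 \<and> (\<forall>d\<in>set m. d = 0)"
    (is "?L \<longleftrightarrow> ?R")
proof
  assume ?R
  then have "base_val n m = 0" using assms by (subst base_val_eq_0_iff) auto
  then have "base_val n (x # m @ [y, w]) = n ^ (length m + 2) + (y * n + w)"
    using \<open>?R\<close> by (simp add: base_val_append)
  moreover have "y * n + w < n * n"
    using base_val_less[of "[y, w]" n] assms by simp
  ultimately show ?L by simp
next
  assume L: ?L
  define k where "k = base_val n (x # m @ [y, w]) - n ^ (length m + 2)"
  have k: "k < n * n" "base_val n (x # m @ [y, w]) = n ^ (length m + 2) + k"
    using L by (auto simp: k_def)
  have "base_val n (replicate (length m) 0) = 0" using assms by (subst base_val_eq_0_iff) auto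
  \<comment> \<open>A position at distance \<open>k\<close> from the start of the block also has the
    digits 1, 0, ..., 0, k div n, k mod n, and digit lists of a given length are unique.\<close>
  then have "base_val n (1 # replicate (length m) 0 @ [k div n, k mod n]) = base_val n (x # m @ [y, w])"
    using k(2) by (simp add: base_val_append)
  moreover have "k div n < n" using k by (simp add: less_mult_imp_div_less)
  ultimately have "1 # replicate (length m) 0 @ [k div n, k mod n] = x # m @ [y, w]"
    using assms by (subst (asm) base_val_inj) (auto simp: set_replicate_conv_if)
  then show ?R by (auto simp: append_eq_append_conv) (metis in_set_replicate)
qed

section \<open>Inflationary fixed points and tuple assignments\<close>

text \<open>All stages stay inside \<open>S\<close>, and an element of rank \<open>i\<close> has
  entered by stage i + 1, since its membership in \<open>F R\<close> follows as soon as
  \<open>R\<close> contains all elements of lower rank.\<close>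

lemma ifp_eqI:
  fixes rank :: "'a \<Rightarrow> nat"
  assumes sound: "\<And>R. R \<subseteq> S \<Longrightarrow> F R \<subseteq> S"
    and complete: "\<And>R x. R \<subseteq> S \<Longrightarrow> x \<in> S \<Longrightarrow> (\<And>y. y \<in> S \<Longrightarrow> rank y < rank x \<Longrightarrow> y \<in> R) \<Longrightarrow> x \<in> F R"
  shows "ifp F = S"
proof -
  define stage where "stage = (\<lambda>i. ((\<lambda>R. R \<union> F R) ^^ i) {})"
  have stage_Suc: "stage (Suc i) = stage i \<union> F (stage i)" for i by (simp add: stage_def)
  have sub: "stage i \<subseteq> S" for i
    by (induction i) (use sound in \<open>auto simp: stage_Suc, auto simp: stage_def\<close>)
  have "x \<in> stage i" if "x \<in> S" "rank x < i" for x i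
    using that
  proof (induction i arbitrary: x)
    case (Suc i)
    then have "x \<in> F (stage i)" by (intro complete sub) auto
    then show ?case by (simp add: stage_Suc)
  qed simp
  then show ?thesis using sub unfolding ifp_def stage_def[symmetric] by blast
qed

lemma upd_tuple_outside:
  "length vs = length xs \<Longrightarrow> x \<notin> set xs \<Longrightarrow> upd_tuple \<alpha> xs vs x = \<alpha> x"
  unfolding upd_tuple_def by (metis map_of_zip_is_None option.simps(4))

lemma map_upd_tuple:
  "length vs = length xs \<Longrightarrow> distinct xs \<Longrightarrow> map (upd_tuple \<alpha> xs vs) xs = vs"
  by (rule nth_equalityI) (auto simp: upd_tuple_def map_of_zip_nth)

lemma map_upd_tuple_vertices:
  assumes "length vs = length is" "distinct is"
  shows "map (\<lambda>i. upd_tuple \<alpha> (map (Pair Vertex) is) vs (Vertex, i)) is = vs"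
  using map_upd_tuple[of vs "map (Pair Vertex) is" \<alpha>] assms
  by (simp add: o_def distinct_map inj_on_def)

lemma sorted_tuples_replicate:
  "sorted_tuples n (replicate l s) = {as. length as = l \<and> set as \<subseteq> sort_dom n s}"
  by (auto simp: sorted_tuples_def list_all2_conv_all_nth set_conv_nth)

section \<open>Definable orders\<close>

text \<open>Vertex variables 0 to 6 are the parameters of the order, 7 is bound by the counting terms,
  8 is bound in the formulas about the order, and variables from 10 on hold digits of tuples.\<close>

abbreviation (input) VV :: "nat \<Rightarrow> fpc_term" where "VV i \<equiv> Var (Vertex, i)"

definition FFalse :: fpc_form where
  "FFalse = Exists (Vertex, 0) (Neg (Equal (VV 0) (VV 0)))"

definition Disj :: "fpc_form \<Rightarrow> fpc_form \<Rightarrow> fpc_form" where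
  "Disj \<phi> \<psi> = Neg (Conj (Neg \<phi>) (Neg \<psi>))"

definition Conjs :: "fpc_form list \<Rightarrow> fpc_form" where
  "Conjs \<phi>s = foldr Conj \<phi>s (Neg FFalse)"

definition Disjs :: "fpc_form list \<Rightarrow> fpc_form" where
  "Disjs \<phi>s = foldr Disj \<phi>s FFalse"

definition Exs :: "nat list \<Rightarrow> fpc_form \<Rightarrow> fpc_form" where
  "Exs is \<phi> = foldr (\<lambda>i. Exists (Vertex, i)) is \<phi>"

lemma wf_connectives [simp]:
  "wf_form FFalse" "wf_form (Disj \<phi> \<psi>) \<longleftrightarrow> wf_form \<phi> \<and> wf_form \<psi>"
  "wf_form (Conjs \<phi>s) \<longleftrightarrow> (\<forall>\<phi>\<in>set \<phi>s. wf_form \<phi>)" "wf_form (Disjs \<phi>s) \<longleftrightarrow> (\<forall>\<phi>\<in>set \<phi>s. wf_form \<phi>)"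
  "wf_form (Exs is \<phi>) \<longleftrightarrow> wf_form \<phi>"
proof -
  show F: "wf_form FFalse" by (simp add: FFalse_def)
  show D: "wf_form (Disj \<phi> \<psi>) \<longleftrightarrow> wf_form \<phi> \<and> wf_form \<psi>" for \<phi> \<psi> by (simp add: Disj_def)
  show "wf_form (Conjs \<phi>s) \<longleftrightarrow> (\<forall>\<phi>\<in>set \<phi>s. wf_form \<phi>)"
    unfolding Conjs_def by (induction \<phi>s) (auto simp: F)
  show "wf_form (Disjs \<phi>s) \<longleftrightarrow> (\<forall>\<phi>\<in>set \<phi>s. wf_form \<phi>)"
    unfolding Disjs_def by (induction \<phi>s) (auto simp: F D)
  show "wf_form (Exs is \<phi>) \<longleftrightarrow> wf_form \<phi>"
    unfolding Exs_def by (induction "is") auto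
qed

lemma fv_connectives [simp]:
  "fv_form FFalse = {}" "fv_form (Disj \<phi> \<psi>) = fv_form \<phi> \<union> fv_form \<psi>"
  "fv_form (Conjs \<phi>s) = (\<Union>\<phi>\<in>set \<phi>s. fv_form \<phi>)" "fv_form (Disjs \<phi>s) = (\<Union>\<phi>\<in>set \<phi>s. fv_form \<phi>)"
  "fv_form (Exs is \<phi>) = fv_form \<phi> - Pair Vertex ` set is"
proof -
  show F: "fv_form FFalse = {}" by (simp add: FFalse_def)
  show D: "fv_form (Disj \<phi> \<psi>) = fv_form \<phi> \<union> fv_form \<psi>" for \<phi> \<psi> by (simp add: Disj_def)
  show "fv_form (Conjs \<phi>s) = (\<Union>\<phi>\<in>set \<phi>s. fv_form \<phi>)"
    unfolding Conjs_def by (induction \<phi>s) (auto simp: F)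
  show "fv_form (Disjs \<phi>s) = (\<Union>\<phi>\<in>set \<phi>s. fv_form \<phi>)"
    unfolding Disjs_def by (induction \<phi>s) (auto simp: F D)
  show "fv_form (Exs is \<phi>) = fv_form \<phi> - Pair Vertex ` set is"
    unfolding Exs_def by (induction "is") auto
qed

lemma frv_connectives [simp]:
  "frv_form FFalse = {}" "frv_form (Disj \<phi> \<psi>) = frv_form \<phi> \<union> frv_form \<psi>"
  "frv_form (Conjs \<phi>s) = (\<Union>\<phi>\<in>set \<phi>s. frv_form \<phi>)" "frv_form (Disjs \<phi>s) = (\<Union>\<phi>\<in>set \<phi>s. frv_form \<phi>)"
  "frv_form (Exs is \<phi>) = frv_form \<phi>"
proof -
  show F: "frv_form FFalse = {}" by (simp add: FFalse_def)
  show D: "frv_form (Disj \<phi> \<psi>) = frv_form \<phi> \<union> frv_form \<psi>" for \<phi> \<psi> by (simp add: Disj_def)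
  show "frv_form (Conjs \<phi>s) = (\<Union>\<phi>\<in>set \<phi>s. frv_form \<phi>)"
    unfolding Conjs_def by (induction \<phi>s) (auto simp: F)
  show "frv_form (Disjs \<phi>s) = (\<Union>\<phi>\<in>set \<phi>s. frv_form \<phi>)"
    unfolding Disjs_def by (induction \<phi>s) (auto simp: F D)
  show "frv_form (Exs is \<phi>) = frv_form \<phi>"
    unfolding Exs_def by (induction "is") auto
qed

lemma sat_connectives [simp]:
  "\<not> sat G FFalse \<alpha> \<rho>" "sat G (Disj \<phi> \<psi>) \<alpha> \<rho> \<longleftrightarrow> sat G \<phi> \<alpha> \<rho> \<or> sat G \<psi> \<alpha> \<rho>"
  "sat G (Conjs \<phi>s) \<alpha> \<rho> \<longleftrightarrow> (\<forall>\<phi>\<in>set \<phi>s. sat G \<phi> \<alpha> \<rho>)"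
  "sat G (Disjs \<phi>s) \<alpha> \<rho> \<longleftrightarrow> (\<exists>\<phi>\<in>set \<phi>s. sat G \<phi> \<alpha> \<rho>)"
proof -
  show F: "\<not> sat G FFalse \<alpha> \<rho>" by (simp add: FFalse_def)
  show D: "sat G (Disj \<phi> \<psi>) \<alpha> \<rho> \<longleftrightarrow> sat G \<phi> \<alpha> \<rho> \<or> sat G \<psi> \<alpha> \<rho>" for \<phi> \<psi> by (simp add: Disj_def)
  show "sat G (Conjs \<phi>s) \<alpha> \<rho> \<longleftrightarrow> (\<forall>\<phi>\<in>set \<phi>s. sat G \<phi> \<alpha> \<rho>)"
    unfolding Conjs_def by (induction \<phi>s) (auto simp: F)
  show "sat G (Disjs \<phi>s) \<alpha> \<rho> \<longleftrightarrow> (\<exists>\<phi>\<in>set \<phi>s. sat G \<phi> \<alpha> \<rho>)"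
    unfolding Disjs_def by (induction \<phi>s) (auto simp: F D)
qed

text \<open>A single assignment \<open>\<beta>\<close> replaces a chain of nested updates, so that
  values for several blocks of variables can be supplied or extracted at once.\<close>

lemma sat_Exs:
  "sat G (Exs is \<phi>) \<alpha> \<rho> \<longleftrightarrow>
     (\<exists>\<beta>. (\<forall>x. x \<notin> Pair Vertex ` set is \<longrightarrow> \<beta> x = \<alpha> x) \<and>
          (\<forall>i\<in>set is. \<beta> (Vertex, i) \<in> {1..fst G}) \<and> sat G \<phi> \<beta> \<rho>)"
proof (induction "is" arbitrary: \<alpha>)
  case Nil
  have "(\<forall>x. \<beta> x = \<alpha> x) \<longleftrightarrow> \<beta> = \<alpha>" for \<beta> by (simp add: fun_eq_iff)
  then show ?case by (simp add: Exs_def)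
next
  case (Cons i "is")
  have "sat G (Exs (i # is) \<phi>) \<alpha> \<rho> \<longleftrightarrow>
      (\<exists>a\<in>{1..fst G}. sat G (Exs is \<phi>) (\<alpha>((Vertex, i) := a)) \<rho>)"
    by (simp add: Exs_def)
  also have "\<dots> \<longleftrightarrow> (\<exists>\<beta>. (\<forall>x. x \<notin> Pair Vertex ` set (i # is) \<longrightarrow> \<beta> x = \<alpha> x) \<and>
          (\<forall>i\<in>set (i # is). \<beta> (Vertex, i) \<in> {1..fst G}) \<and> sat G \<phi> \<beta> \<rho>)" (is "?L \<longleftrightarrow> ?R")
  proof
    assume ?L
    then obtain a \<beta> where a: "a \<in> {1..fst G}"
      and \<beta>: "\<forall>x. x \<notin> Pair Vertex ` set is \<longrightarrow> \<beta> x = (\<alpha>((Vertex, i) := a)) x"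
        "\<forall>i\<in>set is. \<beta> (Vertex, i) \<in> {1..fst G}" "sat G \<phi> \<beta> \<rho>"
      unfolding Cons.IH by blast
    have "\<beta> (Vertex, i) \<in> {1..fst G}"
      using \<beta>(1)[rule_format, of "(Vertex, i)"] \<beta>(2) a by (cases "i \<in> set is") auto
    then show ?R using \<beta> by (intro exI[of _ \<beta>]) auto
  next
    assume ?R
    then obtain \<beta> where \<beta>: "\<forall>x. x \<notin> Pair Vertex ` set (i # is) \<longrightarrow> \<beta> x = \<alpha> x"
          "\<forall>i\<in>set (i # is). \<beta> (Vertex, i) \<in> {1..fst G}" "sat G \<phi> \<beta> \<rho>" by blast
    show ?L unfolding Cons.IH
      using \<beta> by (intro bexI[of _ "\<beta> (Vertex, i)"] exI[of _ \<beta>]) auto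
  qed
  finally show ?case .
qed

definition CommonNb :: "nat \<Rightarrow> nat \<Rightarrow> fpc_term" where
  "CommonNb u i = Count 7 (Conj (Adj (VV 7) (VV u)) (Adj (VV 7) (VV i)))"

primrec LexLess :: "nat list \<Rightarrow> nat \<Rightarrow> nat \<Rightarrow> fpc_form" where
  "LexLess [] u v = FFalse"
| "LexLess (i # is) u v = Disj
     (Conj (Leq (CommonNb u i) (CommonNb v i)) (Neg (Equal (CommonNb u i) (CommonNb v i))))
     (Conj (Equal (CommonNb u i) (CommonNb v i)) (LexLess is u v))"

definition Lt :: "nat \<Rightarrow> nat \<Rightarrow> fpc_form" where
  "Lt u v = LexLess [0..<7] u v"

definition Min1 :: "nat \<Rightarrow> fpc_form" where
  "Min1 u = Neg (Exists (Vertex, 8) (Lt 8 u))"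

definition Max1 :: "nat \<Rightarrow> fpc_form" where
  "Max1 u = Neg (Exists (Vertex, 8) (Lt u 8))"

definition Succ1 :: "nat \<Rightarrow> nat \<Rightarrow> fpc_form" where
  "Succ1 u v = Conj (Lt u v) (Neg (Exists (Vertex, 8) (Conj (Lt u 8) (Lt 8 v))))"

text \<open>Descends from \<open>u\<close> through \<open>c\<close> predecessors to the minimum. The
  bound variable \<open>Suc u\<close> may also hold a digit of some tuple elsewhere; reusing it is
  harmless because the body reads only \<open>u\<close>, \<open>Suc u\<close> and the
  parameters.\<close>

primrec IsConst :: "nat \<Rightarrow> nat \<Rightarrow> fpc_form" where
  "IsConst 0 u = Min1 u"
| "IsConst (Suc c) u = Exists (Vertex, Suc u) (Conj (Succ1 (Suc u) u) (IsConst c (Suc u)))"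

text \<open>Increment with carry, most significant digit first. Two empty tuples both have value 0,
  so neither succeeds the other.\<close>

fun SuccTuple :: "nat list \<Rightarrow> nat list \<Rightarrow> fpc_form" where
  "SuccTuple (u # us) (v # vs) = Disj
     (Conj (Equal (VV u) (VV v)) (SuccTuple us vs))
     (Conj (Succ1 u v) (Conj (Conjs (map Max1 us)) (Conjs (map Min1 vs))))"
| "SuccTuple _ _ = FFalse"

lemma wf_order_formulas [simp]:
  "wf_form (Lt u v)" "wf_form (Min1 u)" "wf_form (Max1 u)" "wf_form (Succ1 u v)"
  "wf_form (IsConst c u)" "wf_form (SuccTuple us vs)"
proof -
  have "wf_form (LexLess is u v)" for "is" u v
    by (induction "is") (auto simp: CommonNb_def)
  then show L: "wf_form (Lt u v)" for u v by (simp add: Lt_def)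
  show m: "wf_form (Min1 u)" for u by (simp add: Min1_def L)
  show M: "wf_form (Max1 u)" for u by (simp add: Max1_def L)
  show S: "wf_form (Succ1 u v)" for u v by (simp add: Succ1_def L)
  show "wf_form (IsConst c u)" by (induction c arbitrary: u) (simp_all add: m S)
  show "wf_form (SuccTuple us vs)" by (induction us vs rule: SuccTuple.induct) (simp_all add: m M S)
qed

lemma frv_order_formulas [simp]:
  "frv_form (Lt u v) = {}" "frv_form (Min1 u) = {}" "frv_form (Max1 u) = {}"
  "frv_form (Succ1 u v) = {}" "frv_form (IsConst c u) = {}" "frv_form (SuccTuple us vs) = {}"
proof -
  have "frv_form (LexLess is u v) = {}" for "is" u v
    by (induction "is") (auto simp: CommonNb_def)
  then show L: "frv_form (Lt u v) = {}" for u v by (simp add: Lt_def)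
  show m: "frv_form (Min1 u) = {}" for u by (simp add: Min1_def L)
  show M: "frv_form (Max1 u) = {}" for u by (simp add: Max1_def L)
  show S: "frv_form (Succ1 u v) = {}" for u v by (simp add: Succ1_def L)
  show "frv_form (IsConst c u) = {}" by (induction c arbitrary: u) (simp_all add: m S)
  show "frv_form (SuccTuple us vs) = {}"
    by (induction us vs rule: SuccTuple.induct) (simp_all add: m M S)
qed

text \<open>The parameters 0 to 6 are always included, since comparisons in the order read
  them.\<close>

definition vars :: "nat set \<Rightarrow> var set" where
  "vars A = Pair Vertex ` ({..<7} \<union> A)"

lemma fv_order_formulas:
  "fv_form (Lt u v) \<subseteq> vars {u, v}" "fv_form (Min1 u) \<subseteq> vars {u}" "fv_form (Max1 u) \<subseteq> vars {u}"
  "fv_form (Succ1 u v) \<subseteq> vars {u, v}" "fv_form (IsConst c u) \<subseteq> vars {u}"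
  "fv_form (SuccTuple us vs) \<subseteq> vars (set us \<union> set vs)"
proof -
  have "fv_form (LexLess is u v) \<subseteq> Pair Vertex ` (set is \<union> {u, v})" for "is" u v
    by (induction "is") (auto simp: CommonNb_def)
  from this[of "[0..<7]"] show L: "fv_form (Lt u v) \<subseteq> vars {u, v}" for u v
    by (simp add: Lt_def vars_def atLeast0LessThan)
  show m: "fv_form (Min1 u) \<subseteq> vars {u}" for u using L[of 8 u] by (auto simp: Min1_def vars_def)
  show M: "fv_form (Max1 u) \<subseteq> vars {u}" for u using L[of u 8] by (auto simp: Max1_def vars_def)
  show S: "fv_form (Succ1 u v) \<subseteq> vars {u, v}" for u v
    using L[of 8 v] L[of u 8] L[of u v] by (auto simp: Succ1_def vars_def)
  show "fv_form (IsConst c u) \<subseteq> vars {u}"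
  proof (induction c arbitrary: u)
    case (Suc c)
    show ?case using Suc[of "Suc u"] S[of "Suc u" u] by (auto simp: vars_def)
  qed (simp add: m)
  show "fv_form (SuccTuple us vs) \<subseteq> vars (set us \<union> set vs)"
  proof (induction us vs rule: SuccTuple.induct)
    case (1 u us v vs)
    have "(\<Union>x\<in>set us. fv_form (Max1 x)) \<subseteq> vars (set us)" "(\<Union>x\<in>set vs. fv_form (Min1 x)) \<subseteq> vars (set vs)"
      using m M by (fastforce simp: vars_def)+
    then show ?case using 1 S[of u v] by (auto simp: vars_def)
  qed auto
qed

section \<open>The order that seven parameters induce\<close>

locale parametrized_graph =
  fixes G :: graph and xs :: "nat list"
  assumes len: "length xs = 7"
begin

definition n :: nat where "n = fst G"

definition V :: "nat set" where "V = {1..fst G}"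

lemma sort_dom_V: "sort_dom (fst G) Vertex = V"
  by (simp add: V_def)

lemma finite_V [simp]: "finite V" and card_V [simp]: "card V = n"
  by (auto simp: V_def n_def)

text \<open>Turns lexicographic comparison of profiles into comparison of numbers. The base is n + 1
  because a count can be as large as \<open>n\<close>.\<close>

definition key :: "nat \<Rightarrow> nat" where
  "key v = base_val (Suc n) (neighbour_profile G xs v)"

lemma common_neighbours_le: "common_neighbours G x y \<le> n"
proof -
  have "common_neighbours G x y \<le> card {1..fst G}"
    unfolding common_neighbours_def by (rule card_mono) auto
  then show ?thesis by (simp add: n_def)
qed

lemma map_common_neighbours: "set (map (common_neighbours G v) ys) \<subseteq> {..<Suc n}"
  using common_neighbours_le by (auto simp: less_Suc_eq_le)

lemma key_eq_iff: "key u = key v \<longleftrightarrow> neighbour_profile G xs u = neighbour_profile G xs v"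
  using base_val_inj[of "neighbour_profile G xs u" "neighbour_profile G xs v" "Suc n"]
    map_common_neighbours[of u xs] map_common_neighbours[of v xs]
  by (simp add: key_def neighbour_profile_def)

definition ok :: "(var \<Rightarrow> nat) \<Rightarrow> bool" where
  "ok \<alpha> \<longleftrightarrow> (\<forall>i<7. \<alpha> (Vertex, i) = xs ! i)"

lemma ok_upd [simp]: "7 \<le> i \<Longrightarrow> ok (\<alpha>((Vertex, i) := a)) \<longleftrightarrow> ok \<alpha>"
  by (auto simp: ok_def)

lemma eval_CommonNb:
  "u \<noteq> 7 \<Longrightarrow> i \<noteq> 7 \<Longrightarrow> eval_term G (CommonNb u i) \<alpha> \<rho> = common_neighbours G (\<alpha> (Vertex, u)) (\<alpha> (Vertex, i))"
  by (simp add: CommonNb_def common_neighbours_def)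

lemma sat_LexLess:
  "7 \<notin> set is \<Longrightarrow> u \<noteq> 7 \<Longrightarrow> v \<noteq> 7 \<Longrightarrow> sat G (LexLess is u v) \<alpha> \<rho> \<longleftrightarrow>
     base_val (Suc n) (map (\<lambda>i. common_neighbours G (\<alpha> (Vertex, u)) (\<alpha> (Vertex, i))) is) <
     base_val (Suc n) (map (\<lambda>i. common_neighbours G (\<alpha> (Vertex, v)) (\<alpha> (Vertex, i))) is)"
proof (induction "is")
  case (Cons i "is")
  have "set (map (\<lambda>i. common_neighbours G x (\<alpha> (Vertex, i))) is) \<subseteq> {..<Suc n}" for x
    using common_neighbours_le by (auto simp: less_Suc_eq_le)
  then have "base_val (Suc n) (map (\<lambda>i. common_neighbours G (\<alpha> (Vertex, u)) (\<alpha> (Vertex, i))) (i # is)) <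
     base_val (Suc n) (map (\<lambda>i. common_neighbours G (\<alpha> (Vertex, v)) (\<alpha> (Vertex, i))) (i # is)) \<longleftrightarrow>
     common_neighbours G (\<alpha> (Vertex, u)) (\<alpha> (Vertex, i)) < common_neighbours G (\<alpha> (Vertex, v)) (\<alpha> (Vertex, i)) \<or>
     common_neighbours G (\<alpha> (Vertex, u)) (\<alpha> (Vertex, i)) = common_neighbours G (\<alpha> (Vertex, v)) (\<alpha> (Vertex, i)) \<and>
     sat G (LexLess is u v) \<alpha> \<rho>"
    unfolding list.map using Cons by (subst base_val_Cons_less_iff) simp_all
  then show ?case using Cons by (auto simp: eval_CommonNb simp del: base_val.simps list.map)
qed simp

lemma map_ok: "ok \<alpha> \<Longrightarrow> map (\<lambda>i. f (\<alpha> (Vertex, i))) [0..<7] = map f xs"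
  using len by (intro nth_equalityI) (auto simp: ok_def)

lemma sat_Lt_key:
  assumes "ok \<alpha>" "u \<noteq> 7" "v \<noteq> 7"
  shows "sat G (Lt u v) \<alpha> \<rho> \<longleftrightarrow> key (\<alpha> (Vertex, u)) < key (\<alpha> (Vertex, v))"
proof -
  have "map (\<lambda>i. common_neighbours G x (\<alpha> (Vertex, i))) [0..<7] = neighbour_profile G xs x" for x
    unfolding neighbour_profile_def by (rule map_ok[OF assms(1)])
  moreover have "7 \<notin> set [0..<7]" by simp
  ultimately show ?thesis
    unfolding Lt_def key_def using sat_LexLess[of "[0..<7]" u v \<alpha> \<rho>] assms(2,3) by (simp only: not_False_eq_True)
qed

end

text \<open>Injectivity is a separate assumption: the formula \<open>Total\<close> tests it and has
  to be evaluated for arbitrary parameters.\<close>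

locale identified_graph = parametrized_graph +
  assumes inj: "inj_on (neighbour_profile G xs) {1..fst G}"
begin

lemma inj_key: "inj_on key V"
proof (rule inj_onI)
  fix u v assume "u \<in> V" "v \<in> V" "key u = key v"
  then show "u = v" using inj_onD[OF inj, of u v] by (simp add: key_eq_iff V_def)
qed

text \<open>The rank in the order by \<open>key\<close>, counted from 0, so that the vertices act as
  the digits of base \<open>n\<close>.\<close>

definition r :: "nat \<Rightarrow> nat" where
  "r v = card {u \<in> V. key u < key v}"

lemma r_less_iff: "u \<in> V \<Longrightarrow> v \<in> V \<Longrightarrow> r u < r v \<longleftrightarrow> key u < key v"
proof -
  have *: "r u < r v" if "u \<in> V" "v \<in> V" "key u < key v" for u v
  proof -
    have "{w \<in> V. key w < key u} \<subset> {w \<in> V. key w < key v}" using that by fastforce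
    then show ?thesis unfolding r_def by (intro psubset_card_mono) simp_all
  qed
  assume uv: "u \<in> V" "v \<in> V"
  show ?thesis
    using *[of u v] *[of v u] uv inj_onD[OF inj_key, of u v]
    by (cases "key u" "key v" rule: linorder_cases) auto
qed

lemma inj_r: "inj_on r V"
proof (rule inj_onI)
  fix u v assume uv: "u \<in> V" "v \<in> V" "r u = r v"
  then have "\<not> key u < key v" "\<not> key v < key u"
    using r_less_iff[of u v] r_less_iff[of v u] by auto
  then show "u = v" using inj_onD[OF inj_key, of u v] uv by simp
qed

lemma r_eq_iff: "u \<in> V \<Longrightarrow> v \<in> V \<Longrightarrow> r u = r v \<longleftrightarrow> u = v"
  using inj_onD[OF inj_r] by blast

lemma r_less: "v \<in> V \<Longrightarrow> r v < n"
proof -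
  assume v: "v \<in> V"
  then have "{u \<in> V. key u < key v} \<subset> V" by blast
  then have "r v < card V" unfolding r_def by (intro psubset_card_mono) simp_all
  then show ?thesis by simp
qed

lemma bij_r: "bij_betw r V {..<n}"
proof -
  have "r ` V = {..<n}"
    using inj_r r_less by (intro card_subset_eq) (auto simp: card_image)
  then show ?thesis using inj_r by (simp add: bij_betw_def)
qed

lemma ex_r: "k < n \<Longrightarrow> \<exists>v\<in>V. r v = k"
  using bij_r unfolding bij_betw_def by (metis imageE lessThan_iff)

lemma sat_Lt:
  assumes "ok \<alpha>" "u \<noteq> 7" "v \<noteq> 7" "\<alpha> (Vertex, u) \<in> V" "\<alpha> (Vertex, v) \<in> V"
  shows "sat G (Lt u v) \<alpha> \<rho> \<longleftrightarrow> r (\<alpha> (Vertex, u)) < r (\<alpha> (Vertex, v))"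
  using assms by (simp add: sat_Lt_key r_less_iff)

text \<open>The condition 10 \<le> u keeps \<open>u\<close> apart from the parameters and from the
  variables 7 and 8, which the order formulas bind.\<close>

lemma sat_Min1:
  assumes "ok \<alpha>" "10 \<le> u" "\<alpha> (Vertex, u) \<in> V"
  shows "sat G (Min1 u) \<alpha> \<rho> \<longleftrightarrow> r (\<alpha> (Vertex, u)) = 0"
proof -
  have "sat G (Min1 u) \<alpha> \<rho> \<longleftrightarrow> (\<forall>a\<in>V. \<not> r a < r (\<alpha> (Vertex, u)))"
    using assms by (simp add: Min1_def sort_dom_V sat_Lt del: sort_dom.simps)
  also have "\<dots> \<longleftrightarrow> r (\<alpha> (Vertex, u)) = 0"
    using ex_r[of 0] r_less[OF assms(3)] by auto
  finally show ?thesis .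
qed

lemma sat_Max1:
  assumes "ok \<alpha>" "10 \<le> u" "\<alpha> (Vertex, u) \<in> V"
  shows "sat G (Max1 u) \<alpha> \<rho> \<longleftrightarrow> Suc (r (\<alpha> (Vertex, u))) = n"
proof -
  have "sat G (Max1 u) \<alpha> \<rho> \<longleftrightarrow> (\<forall>a\<in>V. \<not> r (\<alpha> (Vertex, u)) < r a)"
    using assms by (simp add: Max1_def sort_dom_V sat_Lt del: sort_dom.simps)
  also have "\<dots> \<longleftrightarrow> Suc (r (\<alpha> (Vertex, u))) = n"
  proof
    assume L: "\<forall>a\<in>V. \<not> r (\<alpha> (Vertex, u)) < r a"
    show "Suc (r (\<alpha> (Vertex, u))) = n"
    proof (rule ccontr)
      assume "Suc (r (\<alpha> (Vertex, u))) \<noteq> n"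
      then have "Suc (r (\<alpha> (Vertex, u))) < n" using r_less[OF assms(3)] by simp
      then obtain a where "a \<in> V" "r a = Suc (r (\<alpha> (Vertex, u)))" using ex_r by blast
      then show False using L by force
    qed
  next
    assume "Suc (r (\<alpha> (Vertex, u))) = n"
    then show "\<forall>a\<in>V. \<not> r (\<alpha> (Vertex, u)) < r a" using r_less by fastforce
  qed
  finally show ?thesis .
qed

lemma sat_Succ1:
  assumes "ok \<alpha>" "10 \<le> u" "10 \<le> v" "\<alpha> (Vertex, u) \<in> V" "\<alpha> (Vertex, v) \<in> V"
  shows "sat G (Succ1 u v) \<alpha> \<rho> \<longleftrightarrow> r (\<alpha> (Vertex, v)) = Suc (r (\<alpha> (Vertex, u)))"
proof -
  have "sat G (Succ1 u v) \<alpha> \<rho> \<longleftrightarrow> r (\<alpha> (Vertex, u)) < r (\<alpha> (Vertex, v)) \<and>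
      (\<forall>a\<in>V. \<not> (r (\<alpha> (Vertex, u)) < r a \<and> r a < r (\<alpha> (Vertex, v))))"
    using assms by (simp add: Succ1_def sort_dom_V sat_Lt del: sort_dom.simps)
  also have "\<dots> \<longleftrightarrow> r (\<alpha> (Vertex, v)) = Suc (r (\<alpha> (Vertex, u)))"
  proof
    assume L: "r (\<alpha> (Vertex, u)) < r (\<alpha> (Vertex, v)) \<and>
      (\<forall>a\<in>V. \<not> (r (\<alpha> (Vertex, u)) < r a \<and> r a < r (\<alpha> (Vertex, v))))"
    then have "Suc (r (\<alpha> (Vertex, u))) < n" using r_less[OF assms(5)] by simp
    then obtain a where "a \<in> V" "r a = Suc (r (\<alpha> (Vertex, u)))" using ex_r by blast
    then show "r (\<alpha> (Vertex, v)) = Suc (r (\<alpha> (Vertex, u)))" using L by force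
  qed auto
  finally show ?thesis .
qed

lemma sat_IsConst:
  assumes "ok \<alpha>" "10 \<le> u" "\<alpha> (Vertex, u) \<in> V"
  shows "sat G (IsConst c u) \<alpha> \<rho> \<longleftrightarrow> r (\<alpha> (Vertex, u)) = c"
  using assms
proof (induction c arbitrary: u \<alpha>)
  case (Suc c)
  have "sat G (IsConst (Suc c) u) \<alpha> \<rho> \<longleftrightarrow> (\<exists>a\<in>V. r (\<alpha> (Vertex, u)) = Suc (r a) \<and> r a = c)"
  proof -
    have "sat G (IsConst c (Suc u)) (\<alpha>((Vertex, Suc u) := a)) \<rho> \<longleftrightarrow> r a = c" if "a \<in> V" for a
    proof -
      have "ok (\<alpha>((Vertex, Suc u) := a))" using Suc.prems by simp
      then have "sat G (IsConst c (Suc u)) (\<alpha>((Vertex, Suc u) := a)) \<rho> \<longleftrightarrow>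
          r ((\<alpha>((Vertex, Suc u) := a)) (Vertex, Suc u)) = c"
        by (rule Suc.IH) (use Suc.prems that in simp_all)
      then show ?thesis by simp
    qed
    moreover have "sat G (Succ1 (Suc u) u) (\<alpha>((Vertex, Suc u) := a)) \<rho> \<longleftrightarrow>
        r (\<alpha> (Vertex, u)) = Suc (r a)" if "a \<in> V" for a
      using Suc.prems that by (simp add: sat_Succ1)
    ultimately show ?thesis
      unfolding IsConst.simps sat.simps fst_conv sort_dom_V by (intro bex_cong refl) simp
  qed
  also have "\<dots> \<longleftrightarrow> r (\<alpha> (Vertex, u)) = Suc c"
    using ex_r[of c] r_less[OF Suc.prems(3)] by auto
  finally show ?case .
qed (simp add: sat_Min1)

definition val :: "nat list \<Rightarrow> nat" where
  "val vs = base_val n (map r vs)"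

lemma digits: "set vs \<subseteq> V \<Longrightarrow> set (map r vs) \<subseteq> {..<n}"
  using r_less by auto

lemma val_less: "set vs \<subseteq> V \<Longrightarrow> val vs < n ^ length vs"
  unfolding val_def using base_val_less[OF digits] by simp

lemma ex_val: "k < n ^ l \<Longrightarrow> \<exists>vs. length vs = l \<and> set vs \<subseteq> V \<and> val vs = k"
proof -
  assume "k < n ^ l"
  then obtain ds where ds: "length ds = l" "set ds \<subseteq> {..<n}" "base_val n ds = k"
    using base_val_surj by blast
  have "map r (map (inv_into V r) ds) = ds"
    using ds(2) bij_r by (auto simp: bij_betw_def f_inv_into_f intro!: map_idI)
  moreover have "set (map (inv_into V r) ds) \<subseteq> V"
    using ds(2) bij_r by (auto simp: bij_betw_def inv_into_into)
  ultimately show ?thesis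
    using ds by (intro exI[of _ "map (inv_into V r) ds"]) (auto simp: val_def simp del: map_map)
qed

abbreviation tup :: "(var \<Rightarrow> nat) \<Rightarrow> nat list \<Rightarrow> nat list" where
  "tup \<alpha> us \<equiv> map (\<lambda>i. \<alpha> (Vertex, i)) us"

definition valid :: "(var \<Rightarrow> nat) \<Rightarrow> nat list \<Rightarrow> bool" where
  "valid \<alpha> us \<longleftrightarrow> (\<forall>i\<in>set us. 10 \<le> i \<and> \<alpha> (Vertex, i) \<in> V)"

lemma sat_Mins:
  assumes "ok \<alpha>" "valid \<alpha> us"
  shows "sat G (Conjs (map Min1 us)) \<alpha> \<rho> \<longleftrightarrow> (\<forall>d\<in>set (map r (tup \<alpha> us)). d = 0)"
  using assms by (auto simp: valid_def sat_Min1)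

lemma sat_SuccTuple:
  assumes "ok \<alpha>" "length us = length vs" "valid \<alpha> us" "valid \<alpha> vs"
  shows "sat G (SuccTuple us vs) \<alpha> \<rho> \<longleftrightarrow> val (tup \<alpha> vs) = Suc (val (tup \<alpha> us))"
  using assms(2-)
proof (induction us vs rule: list_induct2)
  case Nil
  then show ?case by (simp add: val_def)
next
  case (Cons u us v vs)
  have V: "set (tup \<alpha> us) \<subseteq> V" "set (tup \<alpha> vs) \<subseteq> V" "\<alpha> (Vertex, u) \<in> V" "\<alpha> (Vertex, v) \<in> V"
    "10 \<le> u" "10 \<le> v" and va: "valid \<alpha> us" "valid \<alpha> vs"
    using Cons.prems by (auto simp: valid_def)
  have n: "0 < n" using r_less[OF V(3)] by simp
  have M: "sat G (Conjs (map Max1 us)) \<alpha> \<rho> \<longleftrightarrow> (\<forall>d\<in>set (map r (tup \<alpha> us)). Suc d = n)"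
    using va assms(1) by (auto simp: valid_def sat_Max1)
  have "val (tup \<alpha> (v # vs)) = Suc (val (tup \<alpha> (u # us))) \<longleftrightarrow>
     r (\<alpha> (Vertex, u)) = r (\<alpha> (Vertex, v)) \<and> val (tup \<alpha> vs) = Suc (val (tup \<alpha> us)) \<or>
     r (\<alpha> (Vertex, v)) = Suc (r (\<alpha> (Vertex, u))) \<and>
       (\<forall>d\<in>set (map r (tup \<alpha> us)). Suc d = n) \<and> (\<forall>d\<in>set (map r (tup \<alpha> vs)). d = 0)"
    unfolding val_def list.map using Cons.hyps n digits[OF V(1)] digits[OF V(2)]
    by (intro base_val_Cons_eq_Suc_iff) auto
  also have "\<dots> \<longleftrightarrow> sat G (SuccTuple (u # us) (v # vs)) \<alpha> \<rho>"
    using Cons.IH[OF va] M sat_Mins[OF assms(1) va(2)] sat_Succ1[OF assms(1) V(5,6,3,4)] r_eq_iff[OF V(3,4)]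
    by simp
  finally show ?case ..
qed

end

section \<open>Turing machines as local rules\<close>

text \<open>Builds halting into the transition function: a halted machine rewrites the symbol it
  reads and stays. One local rule then covers halted and running configurations alike.\<close>

definition delta :: "tm \<Rightarrow> nat \<Rightarrow> nat \<Rightarrow> nat \<times> nat \<times> move" where
  "delta M q a = (if q = accept_state M \<or> q = reject_state M then (q, a, Stay) else trans_fun M q a)"

lemma tm_step_delta:
  "tm_step M (q, T, h) = (case delta M q (T h) of (q', b, d) \<Rightarrow> (q', T(h := b), move_head d h))"
  by (simp add: delta_def)

text \<open>A tape symbol, with the state attached if the head is on it. A configuration becomes a
  two-way infinite word over an alphabet that is finite for each machine.\<close>

type_synonym cell = "nat \<times> nat option"

fun cell_at :: "tm_config \<Rightarrow> int \<Rightarrow> cell" where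
  "cell_at (q, T, h) p = (T p, if p = h then Some q else None)"

fun written :: "tm \<Rightarrow> cell \<Rightarrow> nat" where
  "written M (a, None) = a"
| "written M (a, Some q) = fst (snd (delta M q a))"

fun arriving :: "tm \<Rightarrow> move \<Rightarrow> cell \<Rightarrow> nat option" where
  "arriving M d (a, None) = None"
| "arriving M d (a, Some q) = (if snd (snd (delta M q a)) = d then Some (fst (delta M q a)) else None)"

text \<open>The head can reach a cell from the left, from the cell itself or from the right. In a
  window of an actual configuration at most one of the three applies, so the order of the cases
  matters only for windows that never occur.\<close>

definition next_cell :: "tm \<Rightarrow> cell \<Rightarrow> cell \<Rightarrow> cell \<Rightarrow> cell" where
  "next_cell M x y z = (written M y,
     case arriving M Move_Right x of Some q \<Rightarrow> Some q | None \<Rightarrow>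
     (case arriving M Stay y of Some q \<Rightarrow> Some q | None \<Rightarrow> arriving M Move_Left z))"

text \<open>Locality of computation, as in the tableau of the Cook-Levin theorem: a cell depends
  only on the three cells around it one step earlier. This is what lets a fixed formula describe a
  step.\<close>

lemma cell_at_step:
  "cell_at (tm_step M c) p = next_cell M (cell_at c (p - 1)) (cell_at c p) (cell_at c (p + 1))"
proof -
  obtain q T h where c: "c = (q, T, h)" by (cases c)
  obtain q' b d where d: "delta M q (T h) = (q', b, d)" by (cases "delta M q (T h)")
  show ?thesis
    unfolding c tm_step_delta d next_cell_def
  proof -
    consider "p = h" | "p = h + 1" | "p = h - 1" | "p \<noteq> h" "p - 1 \<noteq> h" "p + 1 \<noteq> h" by fastforce
    then show "cell_at (case (q', b, d) of (q', b, d) \<Rightarrow> (q', T(h := b), move_head d h)) p =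
        (written M (cell_at (q, T, h) p),
         case arriving M Move_Right (cell_at (q, T, h) (p - 1)) of Some q \<Rightarrow> Some q | None \<Rightarrow>
         (case arriving M Stay (cell_at (q, T, h) p) of Some q \<Rightarrow> Some q | None \<Rightarrow>
          arriving M Move_Left (cell_at (q, T, h) (p + 1))))"
      by cases (use d in \<open>cases d; simp\<close>)+
  qed
qed

definition cells :: "tm \<Rightarrow> cell list" where
  "cells M = List.product [0..<num_symbols M] (None # map Some [0..<num_states M])"

lemma set_cells: "set (cells M) = {..<num_symbols M} \<times> insert None (Some ` {..<num_states M})"
  by (auto simp: cells_def)

definition config :: "tm \<Rightarrow> bool list \<Rightarrow> nat \<Rightarrow> tm_config" where
  "config M w t = (tm_step M ^^ t) (tm_init M w)"

lemma config_Suc: "config M w (Suc t) = tm_step M (config M w t)"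
  by (simp add: config_def)

lemma cell_at_config_Suc:
  "cell_at (config M w (Suc t)) p = next_cell M (cell_at (config M w t) (p - 1))
     (cell_at (config M w t) p) (cell_at (config M w t) (p + 1))"
  unfolding config_Suc by (rule cell_at_step)

lemma delta_bounded:
  assumes "wf_tm M" "q < num_states M" "a < num_symbols M" "delta M q a = (q', b, d)"
  shows "q' < num_states M \<and> b < num_symbols M"
proof (cases "q = accept_state M \<or> q = reject_state M")
  case True
  from assms(4) have "(q', b, d) = (q, a, Stay)" unfolding delta_def if_P[OF True] by (rule sym)
  then have "q' = q" "b = a" by simp_all
  show ?thesis unfolding \<open>q' = q\<close> \<open>b = a\<close> using assms(2,3) by (rule conjI)
next
  case False
  then have "trans_fun M q a = (q', b, d)"
    using assms(4) unfolding delta_def by (simp only: if_not_P not_False_eq_True if_False)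
  moreover have "\<forall>q<num_states M. \<forall>a<num_symbols M.
      case trans_fun M q a of (q', b, d) \<Rightarrow> q' < num_states M \<and> b < num_symbols M"
    using assms(1) unfolding wf_tm_def by (elim conjE)
  then have "case trans_fun M q a of (q', b, d) \<Rightarrow> q' < num_states M \<and> b < num_symbols M"
    using assms(2,3) by (elim allE impE)
  ultimately show ?thesis by simp
qed

lemma config_invariants:
  assumes "wf_tm M"
  shows "case config M w t of (q, T, h) \<Rightarrow>
    q < num_states M \<and> (\<forall>i. T i < num_symbols M) \<and> \<bar>h\<bar> \<le> int t"
proof (induction t)
  case 0
  have "3 \<le> num_symbols M" "start_state M < num_states M" using assms by (simp_all add: wf_tm_def)
  then show ?case by (simp add: config_def tm_init_def)
next
  case (Suc t)
  obtain q T h where c: "config M w t = (q, T, h)" by (cases "config M w t")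
  obtain q' b d where d: "delta M q (T h) = (q', b, d)" by (cases "delta M q (T h)")
  have inv: "q < num_states M" "\<forall>i. T i < num_symbols M" "\<bar>h\<bar> \<le> int t"
    using Suc unfolding c by simp_all
  have "q' < num_states M \<and> b < num_symbols M"
    using delta_bounded[OF assms inv(1) _ d] inv(2) by blast
  then show ?case
    unfolding config_Suc c tm_step_delta d using inv(2,3) \<open>q' < num_states M \<and> b < num_symbols M\<close>
    by (cases d) (simp_all add: fun_upd_def)
qed

lemma cell_at_config_in_cells: "wf_tm M \<Longrightarrow> cell_at (config M w t) p \<in> set (cells M)"
proof -
  assume M: "wf_tm M"
  obtain q T h where c: "config M w t = (q, T, h)" by (cases "config M w t")
  show ?thesis using config_invariants[OF M, of t w] unfolding c set_cells by auto
qed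

lemma config_halted:
  assumes "fst (config M w t) \<in> {accept_state M, reject_state M}" "t \<le> t'"
  shows "fst (config M w t') = fst (config M w t)"
  using assms(2)
proof (induction rule: dec_induct)
  case (step t')
  then show ?case using assms(1) by (cases "config M w t'") (auto simp: config_Suc)
qed simp

text \<open>Halting states are absorbing, so a run that accepts at any time is still accepting when
  the decision is due. The sentence may thus look for acceptance at an arbitrary time and need not
  express the time bound.\<close>

lemma config_accepts_iff:
  assumes "wf_tm M" "tm_decides_in_time M L T"
  shows "(\<exists>t. fst (config M w t) = accept_state M) \<longleftrightarrow> w \<in> L"
proof -
  obtain t0 where t0: "fst (config M w t0) = (if w \<in> L then accept_state M else reject_state M)"
    using assms(2) unfolding tm_decides_in_time_def config_def by blast
  have "fst (config M w t) = fst (config M w t0)" if "fst (config M w t) = accept_state M" for t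
  proof -
    have "fst (config M w (max t t0)) = fst (config M w t)" using that by (intro config_halted) auto
    moreover have "fst (config M w (max t t0)) = fst (config M w t0)"
      using t0 by (intro config_halted) auto
    ultimately show ?thesis by simp
  qed
  then show ?thesis using t0 assms(1) by (auto simp: wf_tm_def split: if_splits)
qed

lemma cell_at_head: "snd (cell_at c p) = Some q \<longleftrightarrow> p = snd (snd c) \<and> q = fst c"
  by (cases c) auto

section \<open>Adjacency matrices as input words\<close>

lemma nth_concat_map_rows:
  assumes "\<And>i. i < m \<Longrightarrow> length (g i) = n" "i < m" "j < n"
  shows "concat (map g [0..<m]) ! (i * n + j) = g i ! j"
  using assms
proof (induction m)
  case (Suc m)
  have len: "length (concat (map g [0..<m])) = m * n"
  proof -
    have "map length (map g [0..<m]) = map (\<lambda>_. n) [0..<m]" using Suc.prems(1) by simp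
    then show ?thesis unfolding length_concat by (simp only: sum_list_triv length_upt) simp
  qed
  show ?case
  proof (cases "i < m")
    case True
    then have "Suc i * n \<le> m * n" by (intro mult_le_mono1) simp
    then have "i * n + j < m * n" using Suc.prems(3) by simp
    then show ?thesis using Suc True len by (simp add: nth_append)
  next
    case False
    then have "i = m" using Suc.prems(2) by simp
    then show ?thesis using Suc.prems len by (simp add: nth_append)
  qed
qed simp

lemma encode_graph_rows:
  "encode_graph H = concat (map (\<lambda>i. map (\<lambda>j. {Suc i, Suc j} \<in> snd H) [0..<fst H]) [0..<fst H])"
proof -
  have "[1..<Suc (fst H)] = map Suc [0..<fst H]" by (simp add: map_Suc_upt)
  then show ?thesis by (simp only: encode_graph_def map_map o_def)
qed

lemma length_encode_graph: "length (encode_graph H) = fst H * fst H"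
  by (simp add: encode_graph_rows length_concat o_def sum_list_triv)

lemma nth_encode_graph:
  "i < fst H \<Longrightarrow> j < fst H \<Longrightarrow> encode_graph H ! (i * fst H + j) \<longleftrightarrow> {Suc i, Suc j} \<in> snd H"
  unfolding encode_graph_rows by (subst nth_concat_map_rows) auto

text \<open>The language decided by the machine is an image under \<open>encode_graph\<close>; to
  return from an accepted word to the graph, the encoding must be injective. The length of the word
  gives the number of vertices, the entries give the edges.\<close>

lemma encode_graph_inj:
  assumes "is_graph H" "is_graph H'" "encode_graph H = encode_graph H'"
  shows "H = H'"
proof (rule prod_eqI)
  have "(fst H)\<^sup>2 = (fst H')\<^sup>2"
    using arg_cong[OF assms(3), of length] by (simp only: length_encode_graph power2_eq_square)
  then show n: "fst H = fst H'" by simp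
  have *: "{x, y} \<in> snd H \<longleftrightarrow> {x, y} \<in> snd H'" if "x \<in> {1..fst H}" "y \<in> {1..fst H}" for x y
  proof -
    have "x - 1 < fst H" "y - 1 < fst H" "Suc (x - 1) = x" "Suc (y - 1) = y" using that by auto
    then show ?thesis
      using nth_encode_graph[of "x - 1" H "y - 1"] nth_encode_graph[of "x - 1" H' "y - 1"]
      unfolding assms(3) n[symmetric] by metis
  qed
  have "e \<in> snd H \<longleftrightarrow> e \<in> snd H'" if "e \<in> nsets {1..fst H} 2" for e
    using nsets2_E[OF that] * by metis
  then show "snd H = snd H'"
    using assms(1,2) unfolding is_graph_def n[symmetric] by blast
qed

text \<open>Closure of a class under isomorphism leads from \<open>G\<close> to its ordered copy;
  the way back needs symmetry. Edges lie inside the vertex set, so the inverse bijection undoes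
  their images.\<close>

lemma graph_iso_sym: 
  assumes "is_graph G" "graph_iso G H"
  shows "graph_iso H G"
proof -
  obtain f where f: "fst G = fst H" "bij_betw f {1..fst G} {1..fst H}" "snd H = (\<lambda>e. f ` e) ` snd G"
    using assms(2) by (auto simp: graph_iso_def)
  define g where "g = inv_into {1..fst G} f"
  have "g ` f ` e = e" if "e \<in> snd G" for e
  proof -
    have "e \<subseteq> {1..fst G}" using that assms(1) by (auto simp: is_graph_def nsets_def)
    then show ?thesis
      unfolding g_def using f(2) by (simp add: bij_betw_def inv_into_image_cancel)
  qed
  then have "snd G = (\<lambda>e. g ` e) ` snd H" by (simp add: f(3) image_image)
  moreover have "bij_betw g {1..fst H} {1..fst G}"
    unfolding g_def using f(2) by (rule bij_betw_inv_into)
  ultimately show ?thesis using f(1) unfolding graph_iso_def by auto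
qed

section \<open>The simulating sentence\<close>

text \<open>Variables from 10 on are laid out in five consecutive blocks of e + 3 digits, followed
  by four variables for cells. With e + 3 digits, times and positions range below n^(e + 3).\<close>

definition block :: "nat \<Rightarrow> nat \<Rightarrow> nat list" where
  "block e k = [10 + k * (e + 3)..<10 + k * (e + 3) + (e + 3)]"

definition time_vars :: "nat \<Rightarrow> nat list" where "time_vars e = block e 0"
definition pos_vars :: "nat \<Rightarrow> nat list" where "pos_vars e = block e 1"
definition time_vars' :: "nat \<Rightarrow> nat list" where "time_vars' e = block e 2"
definition left_vars :: "nat \<Rightarrow> nat list" where "left_vars e = block e 3"
definition right_vars :: "nat \<Rightarrow> nat list" where "right_vars e = block e 4"
definition cell_var :: "nat \<Rightarrow> nat" where "cell_var e = 10 + 5 * (e + 3)"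

lemmas vars_defs = time_vars_def pos_vars_def time_vars'_def left_vars_def right_vars_def cell_var_def block_def

definition fact_vars :: "nat \<Rightarrow> nat list" where
  "fact_vars e = time_vars e @ pos_vars e @ [cell_var e]"

definition aux_vars :: "nat \<Rightarrow> nat list" where
  "aux_vars e = time_vars' e @ left_vars e @ right_vars e @
     [cell_var e + 1, cell_var e + 2, cell_var e + 3]"

text \<open>The relation built by the fixed point consists of tuples of a time, a position and one
  vertex, whose rank is the \<open>to_nat\<close> code of the cell found there.\<close>

definition fact_relvar :: "nat \<Rightarrow> relvar" where
  "fact_relvar e = (replicate (2 * (e + 3) + 1) Vertex, 0)"

definition Fact :: "nat \<Rightarrow> nat list \<Rightarrow> nat list \<Rightarrow> nat \<Rightarrow> fpc_form" where
  "Fact e ts ps z = Rel (fact_relvar e) (map VV (ts @ ps @ [z]))"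

definition IsCell :: "cell \<Rightarrow> nat \<Rightarrow> fpc_form" where
  "IsCell c z = IsConst (to_nat c) z"

text \<open>The digits of the position are the variables 13 + e to 15 + 2 * e: a leading digit, then
  \<open>e\<close> digits, then the row and the column of the matrix entry.\<close>

definition InBlock :: "nat \<Rightarrow> fpc_form" where
  "InBlock e = Conj (IsConst 1 (13 + e)) (Conjs (map Min1 [14 + e..<14 + 2 * e]))"

definition AtOrigin :: "nat \<Rightarrow> fpc_form" where
  "AtOrigin e = Conj (Min1 (14 + 2 * e)) (Min1 (15 + 2 * e))"

text \<open>Row and column are themselves vertices of the graph, so the matrix entry they address is
  simply their adjacency.\<close>

definition Bit :: "nat \<Rightarrow> fpc_form" where
  "Bit e = Adj (VV (14 + 2 * e)) (VV (15 + 2 * e))"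

definition Init :: "tm \<Rightarrow> nat \<Rightarrow> fpc_form" where
  "Init M e = Disj (Conj (Neg (InBlock e)) (IsCell (0, None) (cell_var e)))
     (Conj (InBlock e) (Disjs
       [Conj (Neg (AtOrigin e)) (Conj (Neg (Bit e)) (IsCell (1, None) (cell_var e))),
        Conj (Neg (AtOrigin e)) (Conj (Bit e) (IsCell (2, None) (cell_var e))),
        Conj (AtOrigin e) (Conj (Neg (Bit e)) (IsCell (1, Some (start_state M)) (cell_var e))),
        Conj (AtOrigin e) (Conj (Bit e) (IsCell (2, Some (start_state M)) (cell_var e)))]))"

text \<open>The transition table is written out as a finite disjunction over all windows; the
  variables after \<open>cell_var e\<close> hold the old left, middle and right cells.\<close>

definition Transition :: "tm \<Rightarrow> nat \<Rightarrow> fpc_form" where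
  "Transition M e = Disjs (map (\<lambda>(x, y, z).
     Conj (IsCell x (cell_var e + 1)) (Conj (IsCell y (cell_var e + 2)) (Conj (IsCell z (cell_var e + 3))
       (IsCell (next_cell M x y z) (cell_var e)))))
     (List.product (cells M) (List.product (cells M) (cells M))))"

definition Step :: "tm \<Rightarrow> nat \<Rightarrow> fpc_form" where
  "Step M e = Exs (aux_vars e) (Conjs
     [SuccTuple (time_vars' e) (time_vars e), SuccTuple (left_vars e) (pos_vars e),
      SuccTuple (pos_vars e) (right_vars e),
      Fact e (time_vars' e) (left_vars e) (cell_var e + 1),
      Fact e (time_vars' e) (pos_vars e) (cell_var e + 2),
      Fact e (time_vars' e) (right_vars e) (cell_var e + 3),
      Transition M e])"

definition Run :: "tm \<Rightarrow> nat \<Rightarrow> fpc_form" where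
  "Run M e = Disj (Conj (Conjs (map Min1 (time_vars e))) (Init M e)) (Step M e)"

definition Accept :: "tm \<Rightarrow> nat \<Rightarrow> fpc_form" where
  "Accept M e = Exs (fact_vars e) (Conj
     (Ifp 0 (map (Pair Vertex) (fact_vars e)) (Run M e) (map VV (fact_vars e)))
     (Disjs (map (\<lambda>s. IsCell (s, Some (accept_state M)) (cell_var e)) [0..<num_symbols M])))"

definition Total :: fpc_form where
  "Total = Neg (Exs [10, 11] (Conj (Neg (Equal (VV 10) (VV 11))) (Conj (Neg (Lt 10 11)) (Neg (Lt 11 10)))))"

definition Sentence :: "tm \<Rightarrow> nat \<Rightarrow> fpc_form" where
  "Sentence M e = Exs [0..<7] (Conj Total (Accept M e))"

section \<open>Variable layout, well-formedness and closedness of the sentence\<close>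

lemma length_vars [simp]:
  "length (time_vars e) = e + 3" "length (pos_vars e) = e + 3" "length (time_vars' e) = e + 3"
  "length (left_vars e) = e + 3" "length (right_vars e) = e + 3"
  "length (fact_vars e) = 2 * (e + 3) + 1" "length (aux_vars e) = 3 * (e + 3) + 3"
  by (simp_all add: vars_defs fact_vars_def aux_vars_def)

lemma distinct_vars: "distinct (fact_vars e)" "distinct (aux_vars e)"
  by (auto simp: vars_defs fact_vars_def aux_vars_def)

lemma disjoint_vars: "set (fact_vars e) \<inter> set (aux_vars e) = {}"
  by (auto simp: vars_defs fact_vars_def aux_vars_def)

lemma vars_ge: "i \<in> set (fact_vars e) \<union> set (aux_vars e) \<Longrightarrow> 10 \<le> i"
  by (auto simp: vars_defs fact_vars_def aux_vars_def)

lemma pos_vars_eq: "pos_vars e = (13 + e) # [14 + e..<14 + 2 * e] @ [14 + 2 * e, 15 + 2 * e]"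
proof -
  have "pos_vars e = [13 + e..<16 + 2 * e]"
    unfolding vars_defs by (rule arg_cong2[where f = upt]) simp_all
  also have "\<dots> = (13 + e) # [14 + e..<16 + 2 * e]" by (subst upt_conv_Cons) simp_all
  also have "[14 + e..<16 + 2 * e] = [14 + e..<14 + 2 * e] @ [14 + 2 * e..<14 + 2 * e + 2]"
  proof -
    have "16 + 2 * e = 14 + 2 * e + 2" by simp
    then show ?thesis by (simp only:) (rule upt_add_eq_append, simp)
  qed
  also have "[14 + 2 * e..<14 + 2 * e + 2] = [14 + 2 * e, 15 + 2 * e]"
    by (simp add: upt_conv_Cons)
  finally show ?thesis .
qed

lemma wf_Fact: "length ts = e + 3 \<Longrightarrow> length ps = e + 3 \<Longrightarrow> wf_form (Fact e ts ps z)"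
proof -
  assume "length ts = e + 3" "length ps = e + 3"
  then have len: "length (ts @ ps @ [z]) = 2 * (e + 3) + 1" by simp
  have "map sort_of (map VV is) = replicate (length is) Vertex" for "is" by (induction "is") simp_all
  then have "map sort_of (map VV (ts @ ps @ [z])) = replicate (2 * (e + 3) + 1) Vertex"
    unfolding len[symmetric] .
  moreover have "list_all wf_term (map VV (ts @ ps @ [z]))" by (auto simp: list_all_iff)
  ultimately show ?thesis unfolding Fact_def fact_relvar_def wf_form.simps fst_conv by blast
qed

lemma wf_Sentence: "wf_form (Sentence M e)"
proof -
  have "wf_form (IsCell c z)" for c z by (simp add: IsCell_def)
  moreover have "wf_form (Init M e)"
    by (auto simp: Init_def InBlock_def AtOrigin_def Bit_def IsCell_def)
  moreover have "wf_form (Step M e)"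
    by (auto simp: Step_def wf_Fact Transition_def IsCell_def)
  ultimately show ?thesis
    by (auto simp: Sentence_def Total_def Accept_def Run_def distinct_vars distinct_map inj_on_def list_all_iff)
qed

lemma frv_Sentence: "frv_form (Sentence M e) = {}"
proof -
  have C: "frv_form (IsCell c z) = {}" for c z by (simp add: IsCell_def)
  moreover have "frv_form (Init M e) = {}"
    by (auto simp: Init_def InBlock_def AtOrigin_def Bit_def IsCell_def)
  moreover have "frv_form (Step M e) \<subseteq> {fact_relvar e}"
    by (auto simp: Step_def Fact_def Transition_def IsCell_def)
  moreover have "(map fst (map (Pair Vertex) (fact_vars e)), 0) = fact_relvar e"
    by (simp add: fact_relvar_def o_def map_replicate_const)
  ultimately show ?thesis
    by (auto simp: Sentence_def Total_def Accept_def Run_def)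
qed

lemma fv_Fact: "fv_form (Fact e ts ps z) = Pair Vertex ` (set ts \<union> set ps \<union> {z})"
  by (auto simp: Fact_def)

lemma fv_Sentence: "fv_form (Sentence M e) = {}"
proof -
  let ?F = "set (fact_vars e)" and ?A = "set (aux_vars e)"
  have C: "fv_form (IsCell c z) \<subseteq> vars {z}" for c z
    unfolding IsCell_def by (rule fv_order_formulas)
  have mono: "vars A \<subseteq> vars B" if "A \<subseteq> B" for A B using that by (auto simp: vars_def)
  have sub: "set (time_vars e) \<subseteq> ?F" "set (pos_vars e) \<subseteq> ?F" "cell_var e \<in> ?F"
    "set (time_vars' e) \<subseteq> ?A" "set (left_vars e) \<subseteq> ?A" "set (right_vars e) \<subseteq> ?A"
    "cell_var e + 1 \<in> ?A" "cell_var e + 2 \<in> ?A" "cell_var e + 3 \<in> ?A"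
    by (auto simp: fact_vars_def aux_vars_def)
  have mins: "fv_form (Conjs (map Min1 us)) \<subseteq> vars ?F" if "set us \<subseteq> ?F" for us
  proof -
    have "fv_form (Min1 u) \<subseteq> vars ?F" if "u \<in> set us" for u
      using fv_order_formulas(2)[of u] mono[of "{u}" ?F] \<open>set us \<subseteq> ?F\<close> that by blast
    then show ?thesis by (simp add: UN_least)
  qed
  have cell: "fv_form (IsCell c z) \<subseteq> vars B" if "z \<in> B" for c z B
    using C[of c z] mono[of "{z}" B] that by blast
  have "fv_form (IsConst 1 (13 + e)) \<subseteq> vars ?F"
    using fv_order_formulas(5)[of 1 "13 + e"] mono[of "{13 + e}" ?F] sub(2) unfolding pos_vars_eq by simp
  then have InBlock: "fv_form (InBlock e) \<subseteq> vars ?F"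
    using mins[of "[14 + e..<14 + 2 * e]"] sub(2) unfolding pos_vars_eq InBlock_def fv_form.simps by simp
  have AtOrigin: "fv_form (AtOrigin e) \<subseteq> vars ?F"
    using mins[of "[14 + 2 * e, 15 + 2 * e]"] sub(2) unfolding pos_vars_eq AtOrigin_def by simp
  have Bit: "fv_form (Bit e) \<subseteq> vars ?F"
    using sub(2) unfolding pos_vars_eq Bit_def by (auto simp: vars_def)
  have I: "fv_form (Init M e) \<subseteq> vars ?F"
    using cell[OF sub(3)] InBlock AtOrigin Bit by (simp add: Init_def)
  have T: "fv_form (Transition M e) \<subseteq> vars (?F \<union> ?A)"
    unfolding Transition_def fv_connectives
  proof (rule UN_least)
    fix \<phi> assume "\<phi> \<in> set (map (\<lambda>(x, y, z).
     Conj (IsCell x (cell_var e + 1)) (Conj (IsCell y (cell_var e + 2)) (Conj (IsCell z (cell_var e + 3))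
       (IsCell (next_cell M x y z) (cell_var e)))))
     (List.product (cells M) (List.product (cells M) (cells M))))"
    then obtain x y z where "\<phi> = Conj (IsCell x (cell_var e + 1)) (Conj (IsCell y (cell_var e + 2))
        (Conj (IsCell z (cell_var e + 3)) (IsCell (next_cell M x y z) (cell_var e))))"
      by auto
    then show "fv_form \<phi> \<subseteq> vars (?F \<union> ?A)"
      using cell[of "cell_var e" "?F \<union> ?A"] cell[of "cell_var e + 1" "?F \<union> ?A"]
        cell[of "cell_var e + 2" "?F \<union> ?A"] cell[of "cell_var e + 3" "?F \<union> ?A"] sub
      by simp
  qed
  have "fv_form (SuccTuple us vs) \<subseteq> vars (?F \<union> ?A)" if "set us \<subseteq> ?F \<union> ?A" "set vs \<subseteq> ?F \<union> ?A" for us vs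
    using fv_order_formulas(6)[of us vs] mono[of "set us \<union> set vs" "?F \<union> ?A"] that by blast
  moreover have "fv_form (Fact e ts ps z) \<subseteq> vars (?F \<union> ?A)"
    if "set ts \<subseteq> ?F \<union> ?A" "set ps \<subseteq> ?F \<union> ?A" "z \<in> ?F \<union> ?A" for ts ps z
    using that by (auto simp: fv_Fact vars_def)
  ultimately have "fv_form (Step M e) \<subseteq> vars (?F \<union> ?A) - Pair Vertex ` ?A"
    using T sub unfolding Step_def by (simp add: le_supI2 le_supI1 Diff_mono)
  also have "\<dots> \<subseteq> vars ?F" by (auto simp: vars_def)
  finally have "fv_form (Run M e) \<subseteq> vars ?F"
    using I mins[OF sub(1)] unfolding Run_def by simp
  then have "fv_form (Accept M e) \<subseteq> vars {}"
  proof -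
    have "(\<Union>s\<in>set (map (\<lambda>s. IsCell (s, Some (accept_state M)) (cell_var e)) [0..<num_symbols M]). fv_form s)
        \<subseteq> vars ?F"
      using cell[OF sub(3)] by (simp add: UN_least)
    moreover have "fv_form (Ifp 0 (map (Pair Vertex) (fact_vars e)) (Run M e) (map VV (fact_vars e))) \<subseteq> vars ?F"
      using \<open>fv_form (Run M e) \<subseteq> vars ?F\<close> by (auto simp: vars_def)
    ultimately have "fv_form (Accept M e) \<subseteq> vars ?F - Pair Vertex ` ?F"
      unfolding Accept_def fv_connectives fv_form.simps by blast
    then show ?thesis by (auto simp: vars_def)
  qed
  moreover have "fv_form Total \<subseteq> vars {}"
    using fv_order_formulas(1)[of 10 11] fv_order_formulas(1)[of 11 10] unfolding Total_def vars_def by auto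
  ultimately show ?thesis unfolding Sentence_def by (auto simp: vars_def)
qed

lemma fpc_sentence_Sentence: "fpc_sentence (Sentence M e)"
  by (simp add: fpc_sentence_def wf_Sentence fv_Sentence frv_Sentence)

section \<open>Correctness of the simulation\<close>

lemma (in parametrized_graph) sat_Total:
  assumes "ok \<alpha>"
  shows "sat G Total \<alpha> \<rho> \<longleftrightarrow> inj_on (neighbour_profile G xs) V"
proof -
  have "sat G Total \<alpha> \<rho> \<longleftrightarrow> (\<forall>a\<in>V. \<forall>b\<in>V. a = b \<or> key a < key b \<or> key b < key a)"
    using assms by (simp add: Total_def Exs_def sat_Lt_key sort_dom_V del: sort_dom.simps)
  then show ?thesis unfolding inj_on_def key_eq_iff[symmetric] by (metis linorder_neqE_nat less_irrefl)
qed

text \<open>The last two assumptions hold for all large \<open>n\<close>: the digit 1, which starts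
  the input block, must exist, and every cell code must be the rank of some vertex.\<close>

locale simulation = identified_graph +
  fixes M :: tm and e :: nat
  assumes graph: "is_graph G" and wf: "wf_tm M" and n_gt_1: "1 < n"
    and cells_less: "\<And>c. c \<in> set (cells M) \<Longrightarrow> to_nat c < n"
begin

text \<open>The copy of \<open>G\<close> that is presented to the machine. Vertex sets start at 1
  while ranks start at 0, hence \<open>Suc\<close>.\<close>

definition relabelled :: graph where
  "relabelled = (n, (\<lambda>e. (\<lambda>v. Suc (r v)) ` e) ` snd G)"

lemma graph_iso_relabelled: "graph_iso G relabelled"
proof -
  have "bij_betw (\<lambda>v. Suc (r v)) {1..fst G} {1..n}"
  proof -
    have "bij_betw (Suc \<circ> r) V {1..n}"
      using bij_r by (rule bij_betw_trans) (auto simp: bij_betw_def image_Suc_lessThan)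
    then show ?thesis by (simp add: o_def V_def)
  qed
  then show ?thesis by (auto simp: graph_iso_def relabelled_def n_def)
qed

lemma edge_subset: "E \<in> snd G \<Longrightarrow> E \<subseteq> V"
  using graph by (auto simp: is_graph_def nsets_def V_def)

lemma relabelled_edge_iff:
  assumes "u \<in> V" "v \<in> V"
  shows "{Suc (r u), Suc (r v)} \<in> snd relabelled \<longleftrightarrow> {u, v} \<in> snd G"
proof
  have inj: "inj_on (\<lambda>v. Suc (r v)) V" using inj_r by (auto simp: inj_on_def)
  assume "{Suc (r u), Suc (r v)} \<in> snd relabelled"
  then obtain E where E: "E \<in> snd G" "(\<lambda>v. Suc (r v)) ` {u, v} = (\<lambda>v. Suc (r v)) ` E"
    by (auto simp: relabelled_def)
  then have "{u, v} = E"
    using inj_on_image_eq_iff[OF inj, of "{u, v}" E] edge_subset assms by simp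
  then show "{u, v} \<in> snd G" using E by simp
next
  assume "{u, v} \<in> snd G"
  then have "(\<lambda>v. Suc (r v)) ` {u, v} \<in> snd relabelled" unfolding relabelled_def snd_conv by (rule imageI)
  then show "{Suc (r u), Suc (r v)} \<in> snd relabelled" by simp
qed

lemma is_graph_relabelled: "is_graph relabelled"
  unfolding is_graph_def
proof
  fix E assume "E \<in> snd relabelled"
  then obtain E' where E': "E' \<in> snd G" "E = (\<lambda>v. Suc (r v)) ` E'" by (auto simp: relabelled_def)
  then obtain u v where uv: "E' = {u, v}" "u \<in> V" "v \<in> V" "u \<noteq> v"
    using graph unfolding is_graph_def V_def by (meson nsets2_E subsetD)
  then show "E \<in> nsets {1..fst relabelled} 2"
    using r_less[of u] r_less[of v] r_eq_iff[of u v] E' by (auto simp: relabelled_def)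
qed

definition input :: "bool list" where "input = encode_graph relabelled"

lemma length_input: "length input = n * n"
  by (simp add: input_def length_encode_graph relabelled_def)

lemma nth_input: "u \<in> V \<Longrightarrow> v \<in> V \<Longrightarrow> input ! (r u * n + r v) \<longleftrightarrow> {u, v} \<in> snd G"
  using nth_encode_graph[of "r u" relabelled "r v"] r_less[of u] r_less[of v] relabelled_edge_iff[of u v]
  by (simp add: input_def relabelled_def)

text \<open>Head positions can be negative, so the tape is shifted to the right. This power of
  \<open>n\<close> has the digits 1, 0, ..., 0, which makes the input block recognisable; the
  exponent is later chosen so that it exceeds twice the running time.\<close>

definition offset :: nat where "offset = n ^ (e + 2)"

definition tape_cell :: "nat \<Rightarrow> nat \<Rightarrow> cell" where
  "tape_cell t p = cell_at (config M input t) (int p - int offset)"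

lemma tape_cell_Suc:
  "0 < p \<Longrightarrow> tape_cell (Suc t) p = next_cell M (tape_cell t (p - 1)) (tape_cell t p) (tape_cell t (p + 1))"
  unfolding tape_cell_def cell_at_config_Suc by (simp add: of_nat_diff algebra_simps)

lemma tape_cell_in_cells: "tape_cell t p \<in> set (cells M)"
  unfolding tape_cell_def by (rule cell_at_config_in_cells[OF wf])

lemma tape_cell_0:
  "tape_cell 0 p = (if offset \<le> p \<and> p < offset + n * n then if input ! (p - offset) then 2 else 1 else 0,
     if p = offset then Some (start_state M) else None)"
proof -
  define N where "N = n * n"
  have "0 \<le> int p - int offset \<and> int p - int offset < int (length input) \<longleftrightarrow> offset \<le> p \<and> p < offset + N"
    unfolding length_input N_def[symmetric] by linarith
  moreover have "nat (int p - int offset) = p - offset" by linarith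
  ultimately show ?thesis
    by (simp add: tape_cell_def config_def tm_init_def N_def)
qed

text \<open>The cells known at time \<open>t\<close> shrink by one at each end of the tape in every step, so that
  no boundary conditions are needed. The input lies far enough from both ends.\<close>

definition facts :: "nat list set" where
  "facts = {vt @ vp @ [c] | vt vp c. length vt = e + 3 \<and> length vp = e + 3 \<and>
     set vt \<subseteq> V \<and> set vp \<subseteq> V \<and> c \<in> V \<and>
     val vt \<le> val vp \<and> val vp + val vt < n ^ (e + 3) \<and> r c = to_nat (tape_cell (val vt) (val vp))}"

lemma mem_facts_iff:
  assumes "length vt = e + 3" "length vp = e + 3"
  shows "vt @ vp @ [c] \<in> facts \<longleftrightarrow> set vt \<subseteq> V \<and> set vp \<subseteq> V \<and> c \<in> V \<and>
     val vt \<le> val vp \<and> val vp + val vt < n ^ (e + 3) \<and> r c = to_nat (tape_cell (val vt) (val vp))"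
  using assms unfolding facts_def by (auto simp: append_eq_append_conv)

lemma valid_fact_vars:
  "valid \<alpha> (fact_vars e) \<longleftrightarrow> set (tup \<alpha> (fact_vars e)) \<subseteq> V"
  using vars_ge[of _ e] by (auto simp: valid_def)

lemma sat_IsCell:
  "ok \<alpha> \<Longrightarrow> 10 \<le> z \<Longrightarrow> \<alpha> (Vertex, z) \<in> V \<Longrightarrow> sat G (IsCell c z) \<alpha> \<rho> \<longleftrightarrow> r (\<alpha> (Vertex, z)) = to_nat c"
  by (simp add: IsCell_def sat_IsConst)

lemma sat_Init:
  assumes ok: "ok \<alpha>" and valid: "valid \<alpha> (fact_vars e)"
  shows "sat G (Init M e) \<alpha> \<rho> \<longleftrightarrow>
     r (\<alpha> (Vertex, cell_var e)) = to_nat (tape_cell 0 (val (tup \<alpha> (pos_vars e))))"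
proof -
  define x where "x = \<alpha> (Vertex, 13 + e)"
  define ms where "ms = tup \<alpha> [14 + e..<14 + 2 * e]"
  define u where "u = \<alpha> (Vertex, 14 + 2 * e)"
  define v where "v = \<alpha> (Vertex, 15 + 2 * e)"
  define p where "p = val (tup \<alpha> (pos_vars e))"
  have vpos: "valid \<alpha> (pos_vars e)" "valid \<alpha> [cell_var e]"
    using valid by (auto simp: valid_def fact_vars_def)
  then have V: "x \<in> V" "set ms \<subseteq> V" "u \<in> V" "v \<in> V" and vms: "valid \<alpha> [14 + e..<14 + 2 * e]"
    unfolding pos_vars_eq by (auto simp: valid_def x_def ms_def u_def v_def)
  have p: "p = base_val n (r x # map r ms @ [r u, r v])"
    unfolding p_def val_def pos_vars_eq by (simp add: x_def ms_def u_def v_def)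
  have len: "length (map r ms) = e" by (simp add: ms_def)
  have "n ^ (length (map r ms) + 2) \<le> base_val n (r x # map r ms @ [r u, r v]) \<and>
      base_val n (r x # map r ms @ [r u, r v]) < n ^ (length (map r ms) + 2) + n * n \<longleftrightarrow>
      r x = 1 \<and> (\<forall>d\<in>set (map r ms). d = 0)"
    using V n_gt_1 by (intro base_val_block_iff r_less digits)
  then have in_block: "offset \<le> p \<and> p < offset + n * n \<longleftrightarrow> r x = 1 \<and> (\<forall>d\<in>set (map r ms). d = 0)"
    unfolding p len offset_def .
  \<comment> \<open>Within the block the last two digits form the row-major index of the entry for
    \<open>u\<close> and \<open>v\<close>, so the input bit there is the adjacency of
    \<open>u\<close> and \<open>v\<close>.\<close>
  have p_block: "p = offset + (r u * n + r v)" if "r x = 1" "\<forall>d\<in>set (map r ms). d = 0"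
  proof -
    have "base_val n (map r ms) = 0" using that n_gt_1 by (subst base_val_eq_0_iff) auto
    then show ?thesis using that len unfolding p by (simp add: base_val_append offset_def)
  qed
  have InBlock: "sat G (InBlock e) \<alpha> \<rho> \<longleftrightarrow> r x = 1 \<and> (\<forall>d\<in>set (map r ms). d = 0)"
  proof -
    have "sat G (IsConst 1 (13 + e)) \<alpha> \<rho> \<longleftrightarrow> r x = 1"
      unfolding x_def using V(1) by (intro sat_IsConst ok) (simp_all add: x_def)
    then show ?thesis unfolding InBlock_def sat.simps sat_Mins[OF ok vms] ms_def by simp
  qed
  have AtOrigin: "sat G (AtOrigin e) \<alpha> \<rho> \<longleftrightarrow> r u = 0 \<and> r v = 0"
    unfolding AtOrigin_def sat.simps using V(3,4) by (simp add: sat_Min1[OF ok] u_def v_def)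
  have Bit: "sat G (Bit e) \<alpha> \<rho> \<longleftrightarrow> {u, v} \<in> snd G"
    by (simp add: Bit_def u_def v_def)
  have cell: "sat G (IsCell c (cell_var e)) \<alpha> \<rho> \<longleftrightarrow> r (\<alpha> (Vertex, cell_var e)) = to_nat c" for c
    using vpos(2) by (intro sat_IsCell ok) (auto simp: valid_def)
  show ?thesis
  proof (cases "r x = 1 \<and> (\<forall>d\<in>set (map r ms). d = 0)")
    case True
    then have "p = offset + (r u * n + r v)" using p_block by blast
    then have "tape_cell 0 p = (if {u, v} \<in> snd G then 2 else 1,
        if r u = 0 \<and> r v = 0 then Some (start_state M) else None)"
      using in_block True nth_input[OF V(3,4)] n_gt_1 by (simp add: tape_cell_0)
    then show ?thesis
      using True unfolding Init_def p_def[symmetric]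
      by (simp add: InBlock AtOrigin Bit cell)
  next
    case False
    \<comment> \<open>The start position of the head is the first cell of the block, so outside the
      block there is no head at time 0.\<close>
    moreover have "p \<noteq> offset"
      using False in_block n_gt_1 by auto
    ultimately have "tape_cell 0 p = (0, None)"
      using in_block by (auto simp: tape_cell_0)
    then show ?thesis
      using False unfolding Init_def p_def[symmetric] by (simp only: sat_connectives sat.simps InBlock cell) simp
  qed
qed

lemma sat_Transition:
  assumes "ok \<alpha>" "valid \<alpha> [cell_var e, cell_var e + 1, cell_var e + 2, cell_var e + 3]"
  shows "sat G (Transition M e) \<alpha> \<rho> \<longleftrightarrow> (\<exists>x\<in>set (cells M). \<exists>y\<in>set (cells M). \<exists>z\<in>set (cells M).
     r (\<alpha> (Vertex, cell_var e + 1)) = to_nat x \<and> r (\<alpha> (Vertex, cell_var e + 2)) = to_nat y \<and>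
     r (\<alpha> (Vertex, cell_var e + 3)) = to_nat z \<and>
     r (\<alpha> (Vertex, cell_var e)) = to_nat (next_cell M x y z))"
proof -
  have cell: "sat G (IsCell c i) \<alpha> \<rho> \<longleftrightarrow> r (\<alpha> (Vertex, i)) = to_nat c"
    if "i \<in> {cell_var e, cell_var e + 1, cell_var e + 2, cell_var e + 3}" for c i
    using assms that by (intro sat_IsCell) (auto simp: valid_def)
  show ?thesis
    unfolding Transition_def sat_connectives
    by (simp add: image_iff split_def cell)
qed

lemma sat_Fact:
  "sat G (Fact e ts ps z) \<alpha> (\<rho>(fact_relvar e := R)) \<longleftrightarrow> tup \<alpha> ts @ tup \<alpha> ps @ [\<alpha> (Vertex, z)] \<in> R"
  by (simp add: Fact_def o_def)

lemma sat_Step: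
  assumes ok: "ok \<alpha>" and valid: "valid \<alpha> (fact_vars e)"
  shows "sat G (Step M e) \<alpha> (\<rho>(fact_relvar e := R)) \<longleftrightarrow>
    (\<exists>vt vl vr a b c. length vt = e + 3 \<and> length vl = e + 3 \<and> length vr = e + 3 \<and>
       set (vt @ vl @ vr @ [a, b, c]) \<subseteq> V \<and>
       val (tup \<alpha> (time_vars e)) = Suc (val vt) \<and>
       val (tup \<alpha> (pos_vars e)) = Suc (val vl) \<and>
       val vr = Suc (val (tup \<alpha> (pos_vars e))) \<and>
       vt @ vl @ [a] \<in> R \<and> vt @ tup \<alpha> (pos_vars e) @ [b] \<in> R \<and> vt @ vr @ [c] \<in> R \<and>
       (\<exists>x\<in>set (cells M). \<exists>y\<in>set (cells M). \<exists>z\<in>set (cells M).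
         r a = to_nat x \<and> r b = to_nat y \<and> r c = to_nat z \<and>
         r (\<alpha> (Vertex, cell_var e)) = to_nat (next_cell M x y z)))" (is "_ \<longleftrightarrow> ?R")
proof -
  define body where "body = Conjs
     [SuccTuple (time_vars' e) (time_vars e), SuccTuple (left_vars e) (pos_vars e),
      SuccTuple (pos_vars e) (right_vars e),
      Fact e (time_vars' e) (left_vars e) (cell_var e + 1),
      Fact e (time_vars' e) (pos_vars e) (cell_var e + 2),
      Fact e (time_vars' e) (right_vars e) (cell_var e + 3),
      Transition M e]"
  let ?\<rho> = "\<rho>(fact_relvar e := R)"
  have sub: "set (time_vars e) \<subseteq> set (fact_vars e)" "set (pos_vars e) \<subseteq> set (fact_vars e)"
      "cell_var e \<in> set (fact_vars e)"
    by (auto simp: fact_vars_def)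
  have body: "tup \<beta> (time_vars e) = tup \<alpha> (time_vars e)" "tup \<beta> (pos_vars e) = tup \<alpha> (pos_vars e)"
      "sat G body \<beta> ?\<rho> \<longleftrightarrow>
       val (tup \<alpha> (time_vars e)) = Suc (val (tup \<beta> (time_vars' e))) \<and>
       val (tup \<alpha> (pos_vars e)) = Suc (val (tup \<beta> (left_vars e))) \<and>
       val (tup \<beta> (right_vars e)) = Suc (val (tup \<alpha> (pos_vars e))) \<and>
       tup \<beta> (time_vars' e) @ tup \<beta> (left_vars e) @ [\<beta> (Vertex, cell_var e + 1)] \<in> R \<and>
       tup \<beta> (time_vars' e) @ tup \<alpha> (pos_vars e) @ [\<beta> (Vertex, cell_var e + 2)] \<in> R \<and>
       tup \<beta> (time_vars' e) @ tup \<beta> (right_vars e) @ [\<beta> (Vertex, cell_var e + 3)] \<in> R \<and>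
       (\<exists>x\<in>set (cells M). \<exists>y\<in>set (cells M). \<exists>z\<in>set (cells M).
         r (\<beta> (Vertex, cell_var e + 1)) = to_nat x \<and> r (\<beta> (Vertex, cell_var e + 2)) = to_nat y \<and>
         r (\<beta> (Vertex, cell_var e + 3)) = to_nat z \<and>
         r (\<alpha> (Vertex, cell_var e)) = to_nat (next_cell M x y z))"
    if \<beta>: "\<forall>x. x \<notin> Pair Vertex ` set (aux_vars e) \<longrightarrow> \<beta> x = \<alpha> x"
      "\<forall>i\<in>set (aux_vars e). \<beta> (Vertex, i) \<in> V" for \<beta>
  proof -
    have eq: "\<beta> (Vertex, i) = \<alpha> (Vertex, i)" if "i \<notin> set (aux_vars e)" for i
      using \<beta>(1) that by auto
    have eqF: "\<beta> (Vertex, i) = \<alpha> (Vertex, i)" if "i \<in> set (fact_vars e)" for i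
      using disjoint_vars[of e] that by (intro eq) auto
    show tp: "tup \<beta> (time_vars e) = tup \<alpha> (time_vars e)" "tup \<beta> (pos_vars e) = tup \<alpha> (pos_vars e)"
      using eqF sub by auto
    have ok': "ok \<beta>"
      unfolding ok_def
    proof (intro allI impI)
      fix i :: nat assume i: "i < 7"
      then have "i \<notin> set (aux_vars e)" using vars_ge[of i e] by auto
      then show "\<beta> (Vertex, i) = xs ! i" using ok i eq by (simp add: ok_def)
    qed
    have va: "valid \<beta> (aux_vars e)" using \<beta>(2) vars_ge[of _ e] by (auto simp: valid_def)
    have vf: "valid \<beta> (fact_vars e)" using valid eqF by (auto simp: valid_def)
    have v: "valid \<beta> (time_vars e)" "valid \<beta> (pos_vars e)" "valid \<beta> (time_vars' e)"
        "valid \<beta> (left_vars e)" "valid \<beta> (right_vars e)"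
        "valid \<beta> [cell_var e, cell_var e + 1, cell_var e + 2, cell_var e + 3]"
      using va vf unfolding valid_def by (auto simp: aux_vars_def fact_vars_def)
    have S:
      "sat G (SuccTuple (time_vars' e) (time_vars e)) \<beta> ?\<rho> \<longleftrightarrow>
         val (tup \<alpha> (time_vars e)) = Suc (val (tup \<beta> (time_vars' e)))"
      "sat G (SuccTuple (left_vars e) (pos_vars e)) \<beta> ?\<rho> \<longleftrightarrow>
         val (tup \<alpha> (pos_vars e)) = Suc (val (tup \<beta> (left_vars e)))"
      "sat G (SuccTuple (pos_vars e) (right_vars e)) \<beta> ?\<rho> \<longleftrightarrow>
         val (tup \<beta> (right_vars e)) = Suc (val (tup \<alpha> (pos_vars e)))"
      using sat_SuccTuple[OF ok' _ v(3) v(1)] sat_SuccTuple[OF ok' _ v(4) v(2)]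
        sat_SuccTuple[OF ok' _ v(2) v(5)] unfolding tp length_vars by blast+
    show "sat G body \<beta> ?\<rho> \<longleftrightarrow>
       val (tup \<alpha> (time_vars e)) = Suc (val (tup \<beta> (time_vars' e))) \<and>
       val (tup \<alpha> (pos_vars e)) = Suc (val (tup \<beta> (left_vars e))) \<and>
       val (tup \<beta> (right_vars e)) = Suc (val (tup \<alpha> (pos_vars e))) \<and>
       tup \<beta> (time_vars' e) @ tup \<beta> (left_vars e) @ [\<beta> (Vertex, cell_var e + 1)] \<in> R \<and>
       tup \<beta> (time_vars' e) @ tup \<alpha> (pos_vars e) @ [\<beta> (Vertex, cell_var e + 2)] \<in> R \<and>
       tup \<beta> (time_vars' e) @ tup \<beta> (right_vars e) @ [\<beta> (Vertex, cell_var e + 3)] \<in> R \<and>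
       (\<exists>x\<in>set (cells M). \<exists>y\<in>set (cells M). \<exists>z\<in>set (cells M).
         r (\<beta> (Vertex, cell_var e + 1)) = to_nat x \<and> r (\<beta> (Vertex, cell_var e + 2)) = to_nat y \<and>
         r (\<beta> (Vertex, cell_var e + 3)) = to_nat z \<and>
         r (\<alpha> (Vertex, cell_var e)) = to_nat (next_cell M x y z))"
      by (simp only: body_def sat_connectives list.set Set.ball_simps simp_thms S sat_Fact
          sat_Transition[OF ok' v(6)] tp eqF[OF sub(3)])
  qed
  have sat: "sat G (Step M e) \<alpha> ?\<rho> \<longleftrightarrow> (\<exists>\<beta>. (\<forall>x. x \<notin> Pair Vertex ` set (aux_vars e) \<longrightarrow> \<beta> x = \<alpha> x) \<and>
      (\<forall>i\<in>set (aux_vars e). \<beta> (Vertex, i) \<in> V) \<and> sat G body \<beta> ?\<rho>)"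
    unfolding Step_def sat_Exs body_def V_def ..
  show ?thesis
  proof
    assume "sat G (Step M e) \<alpha> ?\<rho>"
    then obtain \<beta> where \<beta>: "\<forall>x. x \<notin> Pair Vertex ` set (aux_vars e) \<longrightarrow> \<beta> x = \<alpha> x"
      "\<forall>i\<in>set (aux_vars e). \<beta> (Vertex, i) \<in> V" "sat G body \<beta> ?\<rho>" unfolding sat by blast
    have "set (tup \<beta> (aux_vars e)) \<subseteq> V" using \<beta>(2) by auto
    then have V: "set (tup \<beta> (time_vars' e) @ tup \<beta> (left_vars e) @ tup \<beta> (right_vars e) @
        [\<beta> (Vertex, cell_var e + 1), \<beta> (Vertex, cell_var e + 2), \<beta> (Vertex, cell_var e + 3)]) \<subseteq> V"
      by (simp add: aux_vars_def)
    show ?R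
      by (intro exI[of _ "tup \<beta> (time_vars' e)"] exI[of _ "tup \<beta> (left_vars e)"] exI[of _ "tup \<beta> (right_vars e)"]
        exI[of _ "\<beta> (Vertex, cell_var e + 1)"] exI[of _ "\<beta> (Vertex, cell_var e + 2)"]
        exI[of _ "\<beta> (Vertex, cell_var e + 3)"] conjI[OF _ conjI[OF _ conjI[OF _ conjI[OF V]]]])
        (use \<beta>(3)[unfolded body(3)[OF \<beta>(1,2)]] in simp_all)
  next
    assume ?R
    then obtain vt vl vr a b c where R: "length vt = e + 3" "length vl = e + 3" "length vr = e + 3"
       "set (vt @ vl @ vr @ [a, b, c]) \<subseteq> V"
       "val (tup \<alpha> (time_vars e)) = Suc (val vt) \<and>
       val (tup \<alpha> (pos_vars e)) = Suc (val vl) \<and>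
       val vr = Suc (val (tup \<alpha> (pos_vars e))) \<and>
       vt @ vl @ [a] \<in> R \<and> vt @ tup \<alpha> (pos_vars e) @ [b] \<in> R \<and> vt @ vr @ [c] \<in> R \<and>
       (\<exists>x\<in>set (cells M). \<exists>y\<in>set (cells M). \<exists>z\<in>set (cells M).
         r a = to_nat x \<and> r b = to_nat y \<and> r c = to_nat z \<and>
         r (\<alpha> (Vertex, cell_var e)) = to_nat (next_cell M x y z))" by blast
    define vs where "vs = vt @ vl @ vr @ [a, b, c]"
    define \<beta> where "\<beta> = upd_tuple \<alpha> (map (Pair Vertex) (aux_vars e)) vs"
    have len: "length vs = length (aux_vars e)" using R by (simp add: vs_def)
    have tup: "tup \<beta> (aux_vars e) = vs"
      unfolding \<beta>_def using len distinct_vars(2) by (rule map_upd_tuple_vertices)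
    have \<beta>1: "\<forall>x. x \<notin> Pair Vertex ` set (aux_vars e) \<longrightarrow> \<beta> x = \<alpha> x"
      unfolding \<beta>_def using len by (auto intro: upd_tuple_outside)
    have "set (tup \<beta> (aux_vars e)) \<subseteq> V" using R(4) by (simp only: tup vs_def)
    then have \<beta>2: "\<forall>i\<in>set (aux_vars e). \<beta> (Vertex, i) \<in> V" by auto
    have parts: "tup \<beta> (time_vars' e) = vt" "tup \<beta> (left_vars e) = vl" "tup \<beta> (right_vars e) = vr"
      "\<beta> (Vertex, cell_var e + 1) = a" "\<beta> (Vertex, cell_var e + 2) = b" "\<beta> (Vertex, cell_var e + 3) = c"
      using tup R(1-3) unfolding vs_def aux_vars_def by (simp_all add: append_eq_append_conv)
    have "sat G body \<beta> ?\<rho>"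
      unfolding body(3)[OF \<beta>1 \<beta>2] parts by (rule R(5))
    then show "sat G (Step M e) \<alpha> ?\<rho>" unfolding sat using \<beta>1 \<beta>2 by blast
  qed
qed

end

context simulation
begin

text \<open>Written exactly as the operator in the semantics of \<open>Ifp\<close>, so that
  unfolding \<open>sat\<close> produces it literally.\<close>

definition run_operator :: "(var \<Rightarrow> nat) \<Rightarrow> (relvar \<Rightarrow> nat list set) \<Rightarrow> nat list set \<Rightarrow> nat list set" where
  "run_operator \<alpha> \<rho> R = {as \<in> sorted_tuples (fst G) (map fst (map (Pair Vertex) (fact_vars e))).
     sat G (Run M e) (upd_tuple \<alpha> (map (Pair Vertex) (fact_vars e)) as)
       (\<rho>((map fst (map (Pair Vertex) (fact_vars e)), 0) := R))}"

lemma fact_relvar_eq: "(map fst (map (Pair Vertex) (fact_vars e)), 0) = fact_relvar e"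
  by (simp add: fact_relvar_def o_def map_replicate_const)

lemma sorted_tuples_facts:
  "sorted_tuples (fst G) (map fst (map (Pair Vertex) (fact_vars e))) =
     {as. length as = 2 * (e + 3) + 1 \<and> set as \<subseteq> V}"
proof -
  have "map fst (map (Pair Vertex) (fact_vars e)) = replicate (2 * (e + 3) + 1) Vertex"
    using fact_relvar_eq unfolding fact_relvar_def by simp
  then show ?thesis unfolding sorted_tuples_replicate[symmetric] sort_dom_V[symmetric] by (simp only:)
qed

lemma tuple_split:
  assumes "length as = 2 * (e + 3) + 1"
  obtains vt vp c where "as = vt @ vp @ [c]" "length vt = e + 3" "length vp = e + 3"
proof
  have "as \<noteq> []" using assms by auto
  then show "as = take (e + 3) (butlast as) @ drop (e + 3) (butlast as) @ [last as]"
    unfolding append_assoc[symmetric] append_take_drop_id by (rule append_butlast_last_id[symmetric])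
qed (use assms in simp_all)

lemma mem_run_operator_iff:
  assumes ok: "ok \<alpha>" and len: "length vt = e + 3" "length vp = e + 3"
  shows "vt @ vp @ [c] \<in> run_operator \<alpha> \<rho> R \<longleftrightarrow> set (vt @ vp @ [c]) \<subseteq> V \<and>
     (val vt = 0 \<and> r c = to_nat (tape_cell 0 (val vp)) \<or>
      (\<exists>vt' vl vr x y z. length vt' = e + 3 \<and> length vl = e + 3 \<and> length vr = e + 3 \<and>
       set (vt' @ vl @ vr @ [x, y, z]) \<subseteq> V \<and>
       val vt = Suc (val vt') \<and> val vp = Suc (val vl) \<and> val vr = Suc (val vp) \<and>
       vt' @ vl @ [x] \<in> R \<and> vt' @ vp @ [y] \<in> R \<and> vt' @ vr @ [z] \<in> R \<and>
       (\<exists>cx\<in>set (cells M). \<exists>cy\<in>set (cells M). \<exists>cz\<in>set (cells M).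
         r x = to_nat cx \<and> r y = to_nat cy \<and> r z = to_nat cz \<and>
         r c = to_nat (next_cell M cx cy cz))))" (is "_ \<longleftrightarrow> _ \<and> ?R")
proof -
  define as where "as = vt @ vp @ [c]"
  define \<alpha>' where "\<alpha>' = upd_tuple \<alpha> (map (Pair Vertex) (fact_vars e)) as"
  have len_as: "length as = length (fact_vars e)" using len by (simp add: as_def)
  have tup: "tup \<alpha>' (fact_vars e) = as"
    unfolding \<alpha>'_def using len_as distinct_vars(1) by (rule map_upd_tuple_vertices)
  then have parts: "tup \<alpha>' (time_vars e) = vt" "tup \<alpha>' (pos_vars e) = vp" "\<alpha>' (Vertex, cell_var e) = c"
    using len unfolding as_def fact_vars_def by (simp_all add: append_eq_append_conv)
  have ok': "ok \<alpha>'"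
    unfolding ok_def
  proof (intro allI impI)
    fix i :: nat assume "i < 7"
    then have "i \<notin> set (fact_vars e)" using vars_ge[of i e] by auto
    then have "\<alpha>' (Vertex, i) = \<alpha> (Vertex, i)"
      unfolding \<alpha>'_def using len_as by (intro upd_tuple_outside) auto
    then show "\<alpha>' (Vertex, i) = xs ! i" using ok \<open>i < 7\<close> by (simp add: ok_def)
  qed
  have "sat G (Run M e) \<alpha>' (\<rho>(fact_relvar e := R)) \<longleftrightarrow> ?R" if V: "set as \<subseteq> V"
  proof -
    have valid: "valid \<alpha>' (fact_vars e)" unfolding valid_fact_vars tup by (rule V)
    then have "valid \<alpha>' (time_vars e)" by (auto simp: valid_def fact_vars_def)
    then have "sat G (Conjs (map Min1 (time_vars e))) \<alpha>' (\<rho>(fact_relvar e := R)) \<longleftrightarrow> val vt = 0"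
      using sat_Mins[OF ok', of "time_vars e"] n_gt_1
      unfolding parts val_def by (subst base_val_eq_0_iff) auto
    then show ?thesis
      unfolding Run_def sat_connectives sat.simps sat_Init[OF ok' valid] sat_Step[OF ok' valid] parts
      by (simp only:)
  qed
  moreover have "as \<in> run_operator \<alpha> \<rho> R \<longleftrightarrow> set as \<subseteq> V \<and> sat G (Run M e) \<alpha>' (\<rho>(fact_relvar e := R))"
    unfolding run_operator_def sorted_tuples_facts fact_relvar_eq \<alpha>'_def using len_as by simp
  ultimately show ?thesis unfolding as_def by blast
qed

text \<open>The rank of a fact is its time. A fact at (t + 1, p) rests on the facts at time
  \<open>t\<close> for p - 1, \<open>p\<close> and p + 1; the left one needs t \<le> p - 1 and the
  right one p + 1 + t < n^(e + 3), which are the two range conditions at (t + 1, p). The same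
  equivalence serves soundness and completeness.\<close>

lemma ifp_run_operator:
  assumes ok: "ok \<alpha>"
  shows "ifp (run_operator \<alpha> \<rho>) = facts"
proof (rule ifp_eqI[where rank = "\<lambda>as. val (take (e + 3) as)"])
  fix R assume R: "R \<subseteq> facts"
  show "run_operator \<alpha> \<rho> R \<subseteq> facts"
  proof
    fix as assume as: "as \<in> run_operator \<alpha> \<rho> R"
    then have "length as = 2 * (e + 3) + 1" unfolding run_operator_def sorted_tuples_facts by blast
    then obtain vt vp c where split: "as = vt @ vp @ [c]" and len: "length vt = e + 3" "length vp = e + 3"
      by (rule tuple_split)
    have V: "set vt \<subseteq> V" "set vp \<subseteq> V" "c \<in> V"
      using as[unfolded split mem_run_operator_iff[OF ok len]] by auto
    from as[unfolded split mem_run_operator_iff[OF ok len], THEN conjunct2] show "as \<in> facts"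
    proof (elim disjE exE bexE conjE)
      assume "val vt = 0" "r c = to_nat (tape_cell 0 (val vp))"
      then show ?thesis unfolding split mem_facts_iff[OF len] using V val_less[OF V(2)] len by simp
    next
      fix vt' vl vr x y z cx cy cz
      assume 2: "length vt' = e + 3" "length vl = e + 3" "length vr = e + 3"
       "val vt = Suc (val vt')" "val vp = Suc (val vl)" "val vr = Suc (val vp)"
       "vt' @ vl @ [x] \<in> R" "vt' @ vp @ [y] \<in> R" "vt' @ vr @ [z] \<in> R"
       "r x = to_nat cx" "r y = to_nat cy" "r z = to_nat cz" "r c = to_nat (next_cell M cx cy cz)"
      have "vt' @ vl @ [x] \<in> facts" "vt' @ vp @ [y] \<in> facts" "vt' @ vr @ [z] \<in> facts"
        using 2 R by auto
      then have f: "val vt' \<le> val vl" "val vr + val vt' < n ^ (e + 3)" "r x = to_nat (tape_cell (val vt') (val vl))"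
        "r y = to_nat (tape_cell (val vt') (val vp))" "r z = to_nat (tape_cell (val vt') (val vr))"
        unfolding mem_facts_iff[OF 2(1,2)] mem_facts_iff[OF 2(1) len(2)] mem_facts_iff[OF 2(1,3)] by simp_all
      \<comment> \<open>Cell codes are injective, so the window found by the formula is the true
        window of the run.\<close>
      have "cx = tape_cell (val vt') (val vp - 1)" "cy = tape_cell (val vt') (val vp)"
          "cz = tape_cell (val vt') (val vp + 1)"
        using f(3-5) 2 by simp_all
      then have "r c = to_nat (tape_cell (val vt) (val vp))"
        using 2 by (simp add: tape_cell_Suc)
      then show ?thesis unfolding split mem_facts_iff[OF len] using V 2 f(1,2) by simp
    qed
  qed
next
  fix R as assume R: "R \<subseteq> facts" and as: "as \<in> facts"
    and IH: "\<And>bs. bs \<in> facts \<Longrightarrow> val (take (e + 3) bs) < val (take (e + 3) as) \<Longrightarrow> bs \<in> R"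
  from as obtain vt vp c where split: "as = vt @ vp @ [c]" and len: "length vt = e + 3" "length vp = e + 3"
    and V: "set vt \<subseteq> V" "set vp \<subseteq> V" "c \<in> V"
    and f: "val vt \<le> val vp" "val vp + val vt < n ^ (e + 3)" "r c = to_nat (tape_cell (val vt) (val vp))"
    unfolding facts_def by blast
  show "as \<in> run_operator \<alpha> \<rho> R"
  proof (cases "val vt")
    case 0
    then show ?thesis unfolding split mem_run_operator_iff[OF ok len] using V f(3) by simp
  next
    case (Suc t)
    have "t < n ^ (e + 3)" "val vp - 1 < n ^ (e + 3)" "val vp + 1 < n ^ (e + 3)"
      using f(2) Suc by auto
    obtain vt' where v: "length vt' = e + 3" "set vt' \<subseteq> V" "val vt' = t"
      using ex_val[OF \<open>t < n ^ (e + 3)\<close>] by blast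
    obtain vl where vl: "length vl = e + 3" "set vl \<subseteq> V" "val vl = val vp - 1"
      using ex_val[OF \<open>val vp - 1 < n ^ (e + 3)\<close>] by blast
    obtain vr where vr: "length vr = e + 3" "set vr \<subseteq> V" "val vr = val vp + 1"
      using ex_val[OF \<open>val vp + 1 < n ^ (e + 3)\<close>] by blast
    define cx cy cz where "cx = tape_cell t (val vp - 1)" and "cy = tape_cell t (val vp)"
      and "cz = tape_cell t (val vp + 1)"
    have cells: "cx \<in> set (cells M)" "cy \<in> set (cells M)" "cz \<in> set (cells M)"
      by (auto simp: cx_def cy_def cz_def tape_cell_in_cells)
    obtain x where x: "x \<in> V" "r x = to_nat cx" using ex_r[OF cells_less[OF cells(1)]] by blast
    obtain y where y: "y \<in> V" "r y = to_nat cy" using ex_r[OF cells_less[OF cells(2)]] by blast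
    obtain z where z: "z \<in> V" "r z = to_nat cz" using ex_r[OF cells_less[OF cells(3)]] by blast
    have pos: "0 < val vp" using f(1) Suc by simp
    have "t \<le> val vp - 1" "val vp - 1 + t < n ^ (e + 3)" using f(1,2) Suc by linarith+
    then have "vt' @ vl @ [x] \<in> facts"
      unfolding mem_facts_iff[OF v(1) vl(1)] v vl using v(2) vl(2) x by (simp add: cx_def)
    moreover have "vt' @ vp @ [y] \<in> facts"
      unfolding mem_facts_iff[OF v(1) len(2)] v using v(2) V y f Suc by (simp add: cy_def)
    moreover have "vt' @ vr @ [z] \<in> facts"
      unfolding mem_facts_iff[OF v(1) vr(1)] v vr using v(2) vr(2) z f Suc by (simp add: cz_def)
    moreover have "val (take (e + 3) (vt' @ ws)) < val (take (e + 3) as)" for ws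
      unfolding split using v len Suc by simp
    ultimately have R: "vt' @ vl @ [x] \<in> R" "vt' @ vp @ [y] \<in> R" "vt' @ vr @ [z] \<in> R"
      using IH by blast+
    have c: "r c = to_nat (next_cell M cx cy cz)"
      using f(3) Suc pos by (simp add: tape_cell_Suc cx_def cy_def cz_def)
    have "set (vt @ vp @ [c]) \<subseteq> V" "set (vt' @ vl @ vr @ [x, y, z]) \<subseteq> V"
      using V v(2) vl(2) vr(2) x(1) y(1) z(1) by simp_all
    moreover have "val vt = Suc (val vt')" "val vp = Suc (val vl)" "val vr = Suc (val vp)"
      using Suc v(3) vl(3) vr(3) pos by simp_all
    ultimately show ?thesis
      unfolding split mem_run_operator_iff[OF ok len]
      by (intro conjI disjI2 exI[of _ vt'] exI[of _ vl] exI[of _ vr] exI[of _ x] exI[of _ y] exI[of _ z]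
          bexI[OF _ cells(1)] bexI[OF _ cells(2)] bexI[OF _ cells(3)] v(1) vl(1) vr(1) R x(2) y(2) z(2) c)
  qed
qed

lemma sat_Accept:
  assumes ok: "ok \<alpha>"
  shows "sat G (Accept M e) \<alpha> \<rho> \<longleftrightarrow>
    (\<exists>t p. t \<le> p \<and> p + t < n ^ (e + 3) \<and> snd (tape_cell t p) = Some (accept_state M))"
proof -
  define xs' where "xs' = map (Pair Vertex) (fact_vars e)"
  define acc where "acc = Disjs (map (\<lambda>s. IsCell (s, Some (accept_state M)) (cell_var e)) [0..<num_symbols M])"
  have sat_Conj: "sat G (Conj \<phi> \<psi>) \<beta> \<rho> \<longleftrightarrow> sat G \<phi> \<beta> \<rho> \<and> sat G \<psi> \<beta> \<rho>" for \<phi> \<psi> \<beta> by simp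
  have body: "sat G (Conj (Ifp 0 xs' (Run M e) (map VV (fact_vars e))) acc) \<beta> \<rho> \<longleftrightarrow>
      tup \<beta> (fact_vars e) \<in> facts \<and>
      snd (tape_cell (val (tup \<beta> (time_vars e))) (val (tup \<beta> (pos_vars e)))) = Some (accept_state M)"
    if \<beta>: "\<forall>x. x \<notin> Pair Vertex ` set (fact_vars e) \<longrightarrow> \<beta> x = \<alpha> x"
      "\<forall>i\<in>set (fact_vars e). \<beta> (Vertex, i) \<in> V" for \<beta>
  proof -
    have ok': "ok \<beta>"
      unfolding ok_def
    proof (intro allI impI)
      fix i :: nat assume i: "i < 7"
      then have "i \<notin> set (fact_vars e)" using vars_ge[of i e] by auto
      then show "\<beta> (Vertex, i) = xs ! i" using ok i \<beta>(1)[rule_format, of "(Vertex, i)"] by (auto simp: ok_def)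
    qed
    have z: "cell_var e \<in> set (fact_vars e)" by (simp add: fact_vars_def)
    have cell: "sat G (IsCell c (cell_var e)) \<beta> \<rho> \<longleftrightarrow> r (\<beta> (Vertex, cell_var e)) = to_nat c" for c
      using z \<beta>(2) vars_ge[of "cell_var e" e] by (intro sat_IsCell ok') auto
    have acc: "sat G acc \<beta> \<rho> \<longleftrightarrow>
        (\<exists>s<num_symbols M. r (\<beta> (Vertex, cell_var e)) = to_nat (s, Some (accept_state M)))"
      unfolding acc_def by (auto simp: cell)
    have ifp: "sat G (Ifp 0 xs' (Run M e) (map VV (fact_vars e))) \<beta> \<rho> \<longleftrightarrow> tup \<beta> (fact_vars e) \<in> facts"
    proof -
      have "sat G (Ifp 0 xs' (Run M e) (map VV (fact_vars e))) \<beta> \<rho> \<longleftrightarrow>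
          map (\<lambda>t. eval_term G t \<beta> \<rho>) (map VV (fact_vars e)) \<in> ifp (run_operator \<beta> \<rho>)"
        unfolding sat.simps run_operator_def xs'_def ..
      then show ?thesis by (simp only: ifp_run_operator[OF ok'] map_map o_def eval_term.simps)
    qed
    have rz: "r (\<beta> (Vertex, cell_var e)) = to_nat (tape_cell (val (tup \<beta> (time_vars e))) (val (tup \<beta> (pos_vars e))))"
      if "tup \<beta> (fact_vars e) \<in> facts"
      using that mem_facts_iff[of "tup \<beta> (time_vars e)" "tup \<beta> (pos_vars e)" "\<beta> (Vertex, cell_var e)"]
      by (simp add: fact_vars_def)
    \<comment> \<open>Every cell of the run carries a symbol of the machine, so the finite
      disjunction over symbols misses no accepting cell.\<close>
    have "(\<exists>s<num_symbols M. to_nat (tape_cell t p) = to_nat (s, Some (accept_state M))) \<longleftrightarrow>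
        snd (tape_cell t p) = Some (accept_state M)" for t p
    proof -
      obtain s q where c: "tape_cell t p = (s, q)" by (cases "tape_cell t p")
      then have "s < num_symbols M" using tape_cell_in_cells[of t p] unfolding set_cells by simp
      then show ?thesis unfolding c by auto
    qed
    then show ?thesis unfolding sat_Conj ifp acc using rz by (cases "tup \<beta> (fact_vars e) \<in> facts") (simp_all only: simp_thms)
  qed
  have sat: "sat G (Accept M e) \<alpha> \<rho> \<longleftrightarrow> (\<exists>\<beta>. (\<forall>x. x \<notin> Pair Vertex ` set (fact_vars e) \<longrightarrow> \<beta> x = \<alpha> x) \<and>
      (\<forall>i\<in>set (fact_vars e). \<beta> (Vertex, i) \<in> V) \<and>
      sat G (Conj (Ifp 0 xs' (Run M e) (map VV (fact_vars e))) acc) \<beta> \<rho>)"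
    unfolding Accept_def sat_Exs xs'_def acc_def V_def ..
  show ?thesis
  proof
    assume "sat G (Accept M e) \<alpha> \<rho>"
    then obtain \<beta> where \<beta>: "\<forall>x. x \<notin> Pair Vertex ` set (fact_vars e) \<longrightarrow> \<beta> x = \<alpha> x"
      "\<forall>i\<in>set (fact_vars e). \<beta> (Vertex, i) \<in> V"
      "sat G (Conj (Ifp 0 xs' (Run M e) (map VV (fact_vars e))) acc) \<beta> \<rho>"
      unfolding sat by (elim exE conjE)
    show "\<exists>t p. t \<le> p \<and> p + t < n ^ (e + 3) \<and> snd (tape_cell t p) = Some (accept_state M)"
      using mem_facts_iff[of "tup \<beta> (time_vars e)" "tup \<beta> (pos_vars e)" "\<beta> (Vertex, cell_var e)"]
        \<beta>(3)[unfolded body[OF \<beta>(1,2)]]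
      by (intro exI[of _ "val (tup \<beta> (time_vars e))"] exI[of _ "val (tup \<beta> (pos_vars e))"])
        (simp add: fact_vars_def)
  next
    assume "\<exists>t p. t \<le> p \<and> p + t < n ^ (e + 3) \<and> snd (tape_cell t p) = Some (accept_state M)"
    then obtain t p where tp: "t \<le> p" "p + t < n ^ (e + 3)" "snd (tape_cell t p) = Some (accept_state M)"
      by blast
    then have "t < n ^ (e + 3)" "p < n ^ (e + 3)" by auto
    then obtain vt vp where v: "length vt = e + 3" "set vt \<subseteq> V" "val vt = t"
      "length vp = e + 3" "set vp \<subseteq> V" "val vp = p"
      using ex_val[of t "e + 3"] ex_val[of p "e + 3"] by blast
    obtain c where c: "c \<in> V" "r c = to_nat (tape_cell t p)"
      using ex_r[OF cells_less[OF tape_cell_in_cells]] by blast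
    define as where "as = vt @ vp @ [c]"
    define \<beta> where "\<beta> = upd_tuple \<alpha> (map (Pair Vertex) (fact_vars e)) as"
    have len: "length as = length (fact_vars e)" using v by (simp add: as_def)
    have tup: "tup \<beta> (fact_vars e) = as"
      unfolding \<beta>_def using len distinct_vars(1) by (rule map_upd_tuple_vertices)
    then have parts: "tup \<beta> (time_vars e) = vt" "tup \<beta> (pos_vars e) = vp"
      using v unfolding as_def fact_vars_def by (simp_all add: append_eq_append_conv)
    have \<beta>1: "\<forall>x. x \<notin> Pair Vertex ` set (fact_vars e) \<longrightarrow> \<beta> x = \<alpha> x"
      unfolding \<beta>_def using len by (auto intro: upd_tuple_outside)
    have "set (tup \<beta> (fact_vars e)) \<subseteq> V" using v c by (simp add: tup as_def)
    then have \<beta>2: "\<forall>i\<in>set (fact_vars e). \<beta> (Vertex, i) \<in> V" by auto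
    have "as \<in> facts" unfolding as_def mem_facts_iff[OF v(1,4)] using v c tp by simp
    then have "sat G (Conj (Ifp 0 xs' (Run M e) (map VV (fact_vars e))) acc) \<beta> \<rho>"
      unfolding body[OF \<beta>1 \<beta>2] tup parts v using tp(3) by (rule conjI)
    then show "sat G (Accept M e) \<alpha> \<rho>"
      unfolding sat using \<beta>1 \<beta>2 by (intro exI[of _ \<beta>] conjI)
  qed
qed

text \<open>From left to right any recorded acceptance is genuine. Conversely, at the accepting time
  \<open>t\<close> the head is within \<open>t\<close> of the origin; because of 2t < n^(e + 2), its
  shifted position \<open>p\<close> satisfies t \<le> p and p + t < 2 * n^(e + 2) \<le> n^(e + 3),
  so the accepting cell is among the recorded facts. This is why the time bound enters with a factor
  2.\<close>

lemma sat_Accept_iff_accepted: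
  assumes ok: "ok \<alpha>" and dec: "tm_decides_in_time M L T" and T: "2 * T (n * n) < n ^ (e + 2)"
  shows "sat G (Accept M e) \<alpha> \<rho> \<longleftrightarrow> input \<in> L"
proof
  assume "sat G (Accept M e) \<alpha> \<rho>"
  then obtain t p where "snd (tape_cell t p) = Some (accept_state M)"
    unfolding sat_Accept[OF ok] by blast
  then have "fst (config M input t) = accept_state M"
    unfolding tape_cell_def cell_at_head by simp
  then show "input \<in> L" using config_accepts_iff[OF wf dec, of input] by blast
next
  assume "input \<in> L"
  then obtain t where t: "t \<le> T (n * n)" "fst (config M input t) = accept_state M"
    using dec unfolding tm_decides_in_time_def config_def by (metis length_input)
  define h where "h = snd (snd (config M input t))"
  have h: "\<bar>h\<bar> \<le> int t"
    using config_invariants[OF wf, of t input] by (auto simp: h_def split: prod.splits)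
  define p where "p = nat (int offset + h)"
  have off: "2 * t < offset" using t T by (simp add: offset_def)
  have p: "int p = int offset + h" using h off by (simp add: p_def)
  have "t \<le> p" using p h off by linarith
  moreover have "p + t < n ^ (e + 3)"
  proof -
    have "p + t < 2 * offset" using p h off by linarith
    also have "\<dots> \<le> n * offset" using n_gt_1 by (intro mult_le_mono1) simp
    also have "\<dots> = n ^ (e + 3)" by (simp add: offset_def numeral_3_eq_3 numeral_2_eq_2)
    finally show ?thesis .
  qed
  moreover have "snd (tape_cell t p) = Some (accept_state M)"
    unfolding tape_cell_def cell_at_head using t(2) p by (simp add: h_def)
  ultimately show "sat G (Accept M e) \<alpha> \<rho>" unfolding sat_Accept[OF ok] by blast
qed

lemma input_mem_iff:
  assumes "graph_class C"
  shows "input \<in> encode_graph ` C \<longleftrightarrow> G \<in> C"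
proof
  assume "input \<in> encode_graph ` C"
  then obtain H where H: "H \<in> C" "encode_graph H = encode_graph relabelled"
    by (auto simp: input_def)
  then have "H = relabelled"
    using assms is_graph_relabelled by (intro encode_graph_inj) (auto simp: graph_class_def)
  then show "G \<in> C"
    using H(1) assms graph_iso_sym[OF graph graph_iso_relabelled] unfolding graph_class_def by blast
next
  assume "G \<in> C"
  then have "relabelled \<in> C" using assms graph_iso_relabelled unfolding graph_class_def by blast
  then show "input \<in> encode_graph ` C" by (simp add: input_def)
qed

end

section \<open>From the simulation to the planted clique problem\<close>

lemma sat_Sentence_iff:
  assumes graph: "is_graph G" and C: "graph_class C" and wf: "wf_tm M"
    and dec: "tm_decides_in_time M (encode_graph ` C) T"
    and G: "1 < fst G" "\<And>c. c \<in> set (cells M) \<Longrightarrow> to_nat c < fst G"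
      "2 * T (fst G * fst G) < fst G ^ (e + 2)"
  shows "sat G (Sentence M e) \<alpha> \<rho> \<longleftrightarrow> identifiable 7 G \<and> G \<in> C"
proof -
  have body: "sat G (Conj Total (Accept M e)) \<beta> \<rho> \<longleftrightarrow>
      inj_on (neighbour_profile G xs) {1..fst G} \<and> G \<in> C"
    if xs: "length xs = 7" "\<forall>i<7. \<beta> (Vertex, i) = xs ! i" for xs \<beta>
  proof -
    interpret parametrized_graph G xs by unfold_locales (rule xs)
    have ok: "ok \<beta>" using xs(2) by (simp add: ok_def)
    show ?thesis
    \<comment> \<open>Without injectivity \<open>Total\<close> fails and nothing needs to be known
      about \<open>Accept\<close>; the simulation is only analysed in the other case.\<close>
    proof (cases "inj_on (neighbour_profile G xs) {1..fst G}")
      case True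
      interpret simulation G xs M e
        using True graph wf G by unfold_locales (auto simp: n_def)
      have "sat G (Accept M e) \<beta> \<rho> \<longleftrightarrow> G \<in> C"
        using sat_Accept_iff_accepted[OF ok dec] G(3) input_mem_iff[OF C] by (simp add: n_def)
      then show ?thesis using True sat_Total[OF ok] by (simp add: V_def)
    next
      case False
      then show ?thesis using sat_Total[OF ok] by (simp add: V_def)
    qed
  qed
  show ?thesis
  proof
    assume "sat G (Sentence M e) \<alpha> \<rho>"
    then obtain \<beta> where \<beta>: "\<forall>i\<in>set [0..<7]. \<beta> (Vertex, i) \<in> {1..fst G}"
        "sat G (Conj Total (Accept M e)) \<beta> \<rho>"
      unfolding Sentence_def sat_Exs by blast
    define xs where "xs = map (\<lambda>i. \<beta> (Vertex, i)) [0..<7]"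
    have "length xs = 7" "\<forall>i<7. \<beta> (Vertex, i) = xs ! i" by (simp_all add: xs_def del: upt_Suc)
    moreover have "set xs \<subseteq> {1..fst G}" using \<beta>(1) unfolding xs_def set_map by blast
    ultimately show "identifiable 7 G \<and> G \<in> C"
      using body \<beta>(2) unfolding identifiable_def by blast
  next
    assume "identifiable 7 G \<and> G \<in> C"
    then obtain xs where xs: "length xs = 7" "set xs \<subseteq> {1..fst G}"
      "inj_on (neighbour_profile G xs) {1..fst G}" "G \<in> C" unfolding identifiable_def by blast
    define \<beta> where "\<beta> = (\<lambda>x. if x \<in> Pair Vertex ` {..<7} then xs ! snd x else \<alpha> x)"
    have \<beta>: "\<forall>i<7. \<beta> (Vertex, i) = xs ! i" by (simp add: \<beta>_def)
    show "sat G (Sentence M e) \<alpha> \<rho>"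
      unfolding Sentence_def sat_Exs
    proof (intro exI[of _ \<beta>] conjI)
      show "\<forall>x. x \<notin> Pair Vertex ` set [0..<7] \<longrightarrow> \<beta> x = \<alpha> x"
        unfolding \<beta>_def set_upt atLeast0LessThan by simp
      show "\<forall>i\<in>set [0..<7]. \<beta> (Vertex, i) \<in> {1..fst G}"
      proof
        fix i :: nat assume "i \<in> set [0..<7]"
        then have "i < 7" unfolding set_upt by simp
        then have "xs ! i \<in> set xs" "\<beta> (Vertex, i) = xs ! i" using \<beta> xs(1) by simp_all
        then show "\<beta> (Vertex, i) \<in> {1..fst G}" using xs(2) by auto
      qed
      show "sat G (Conj Total (Accept M e)) \<beta> \<rho>" using body[OF xs(1) \<beta>] xs by blast
    qed
  qed
qed

text \<open>The input has n^2 bits. If \<open>c\<close> is the sum of the coefficients and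
  \<open>d\<close> the degree, the polynomial at n^2 is at most c * n^(2d), and 2c is absorbed by a
  further factor \<open>n\<close>; thus e = 2d works.\<close>

lemma poly_nat_eventually_less_power:
  fixes P :: "nat poly"
  shows "\<exists>e. \<forall>\<^sub>F n in sequentially. 2 * poly P (n * n) < n ^ (e + 2)"
proof -
  define d where "d = degree P"
  define c where "c = (\<Sum>i\<le>d. coeff P i)"
  have "2 * poly P (n * n) < n ^ (2 * d + 2)" if n: "2 * c + 1 \<le> n" for n
  proof -
    have "poly P (n * n) = (\<Sum>i\<le>d. coeff P i * (n * n) ^ i)" by (simp add: poly_altdef d_def)
    also have "\<dots> \<le> (\<Sum>i\<le>d. coeff P i * (n * n) ^ d)"
      using n by (intro sum_mono mult_le_mono2 power_increasing) auto
    also have "\<dots> = c * n ^ (2 * d)"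
      by (simp add: c_def sum_distrib_right power_mult power2_eq_square)
    finally have "2 * poly P (n * n) \<le> (2 * c) * n ^ (2 * d)" by simp
    also have "\<dots> < n * n ^ (2 * d)" using n by (intro mult_strict_right_mono) auto
    also have "\<dots> \<le> n * (n * n ^ (2 * d))" using n by (cases n) auto
    finally show ?thesis by simp
  qed
  then have "\<forall>\<^sub>F n in sequentially. 2 * poly P (n * n) < n ^ (2 * d + 2)"
    by (intro eventually_sequentiallyI[of "2 * c + 1"]) blast
  then show ?thesis by blast
qed

lemma gnp_support: "G \<in> set_pmf (gnp n p) \<Longrightarrow> fst G = n \<and> is_graph G"
  by (auto simp: gnp_def is_graph_def)

lemma gnpk_support: "G \<in> set_pmf (gnpk n p k) \<Longrightarrow> fst G = n"
  by (auto simp: gnpk_def)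

theorem theorem5p11:
  fixes k :: "nat \<Rightarrow> nat" and \<epsilon> :: real
  assumes "\<And>n. k n \<le> n"
    and "\<epsilon> > 0"
    and "planted_clique_solvable_ptime (1 / 2) k (\<lambda>_. \<epsilon>)"
  shows "\<exists>\<delta> :: nat \<Rightarrow> real. \<delta> \<longlonglongrightarrow> 0 \<and> planted_clique_solvable_fpc (1 / 2) k (\<lambda>n. \<epsilon> - \<delta> n)"
proof -
  obtain C where C: "ptime_decidable C" "solves_planted_clique (1 / 2) k (\<lambda>_. \<epsilon>) C"
    using assms(3) unfolding planted_clique_solvable_ptime_def by blast
  then obtain M P where M: "graph_class C" "wf_tm M" "tm_decides_in_time M (encode_graph ` C) (poly P)"
    unfolding ptime_decidable_def ptime_language_def by blast
  obtain e where e: "\<forall>\<^sub>F n in sequentially. 2 * poly P (n * n) < n ^ (e + 2)"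
    using poly_nat_eventually_less_power by blast
  define D where "D = {G. is_graph G \<and> sat G (Sentence M e) (\<lambda>_. 0) (\<lambda>_. {})}"
  define \<delta> where "\<delta> = (\<lambda>n. measure_pmf.prob (gnp n (1 / 2)) {G. \<not> identifiable 7 G})"
  have "fpc_definable D" unfolding fpc_definable_def D_def using fpc_sentence_Sentence by blast
  moreover have "solves_planted_clique (1 / 2) k (\<lambda>n. \<epsilon> - \<delta> n) D"
    unfolding solves_planted_clique_def
  proof -
    \<comment> \<open>A fixed machine has finitely many cells, so for large \<open>n\<close> all
      their codes are ranks of vertices.\<close>
    have cells: "\<forall>\<^sub>F n in sequentially. \<forall>c\<in>set (cells M). to_nat c < n"
      by (intro eventually_ball_finite) (auto intro: eventually_gt_at_top)
    show "\<forall>\<^sub>F n in sequentially. 1 / 2 + (\<epsilon> - \<delta> n) \<le> measure_pmf.prob (gnp n (1 / 2)) D \<and>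
        measure_pmf.prob (gnpk n (1 / 2) (k n)) D \<le> 1 / 2 - (\<epsilon> - \<delta> n)"
      using e cells eventually_gt_at_top[of 1] C(2)[unfolded solves_planted_clique_def]
    proof eventually_elim
      case (elim n)
      have D: "G \<in> D \<longleftrightarrow> identifiable 7 G \<and> G \<in> C" if "fst G = n" "is_graph G" for G
        unfolding D_def using sat_Sentence_iff[OF that(2) M, of e] elim that by simp
      have "measure_pmf.prob (gnp n (1 / 2)) C \<le> measure_pmf.prob (gnp n (1 / 2)) (D \<union> {G. \<not> identifiable 7 G})"
        by (rule measure_pmf.finite_measure_mono_AE) (auto simp: AE_measure_pmf_iff D dest: gnp_support)
      also have "\<dots> \<le> measure_pmf.prob (gnp n (1 / 2)) D + \<delta> n"
        unfolding \<delta>_def by (rule measure_Un_le) auto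
      finally have gnp: "1 / 2 + (\<epsilon> - \<delta> n) \<le> measure_pmf.prob (gnp n (1 / 2)) D" using elim(4) by linarith
      have "measure_pmf.prob (gnpk n (1 / 2) (k n)) D \<le> measure_pmf.prob (gnpk n (1 / 2) (k n)) C"
      proof (rule measure_pmf.finite_measure_mono_AE)
        show "AE G in measure_pmf (gnpk n (1 / 2) (k n)). G \<in> D \<longrightarrow> G \<in> C"
          \<comment> \<open>That the graph is well-formed comes from membership in \<open>D\<close>;
            the support only has to supply the number of vertices.\<close>
          unfolding AE_measure_pmf_iff using D by (auto simp: D_def dest: gnpk_support)
      qed simp
      \<comment> \<open>As a probability \<delta> is nonnegative, so lowering the advantage only
        relaxes the bound for planted graphs.\<close>
      also have "\<dots> \<le> 1 / 2 - (\<epsilon> - \<delta> n)"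
        using elim(4) measure_nonneg[of "measure_pmf (gnp n (1 / 2))" "{G. \<not> identifiable 7 G}"]
        unfolding \<delta>_def by linarith
      finally show ?case using gnp by blast
    qed
  qed
  moreover have "\<delta> \<longlonglongrightarrow> 0" unfolding \<delta>_def by (rule prob_not_identifiable_tendsto)
  ultimately show ?thesis unfolding planted_clique_solvable_fpc_def by blast
qed

end
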